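(* Let $n\ge 1$. (1) $\widetilde{\mathcal J}(\mathbb R^{2n})$ is a Kähler submanifold of $(\mathcal J(\mathbb R^{2n}), ds^2,\tilde J)$. (2) $\widetilde{\mathcal J}(\mathbb R^{2n})$ is a deformation retract of $\mathcal J(\mathbb R^{2n})$.
   Context: $\mathcal J(\mathbb R^{2n})=\{A\in GL(2n,\mathbb R) : A^2=-I\}$, a submanifold of $GL(2n,\mathbb R)$ with tangent space $T_A\mathcal J(\mathbb R^{2n})=\{X\in gl(2n,\mathbb R): AX=-XA\}$ at $A$. The orthogonal twistor space is $\widetilde{\mathcal J}(\mathbb R^{2n})=\{A\in\mathcal J(\mathbb R^{2n}) : A^t=-A\}$, with $T_A\widetilde{\mathcal J}(\mathbb R^{2n})=\{X\in gl(2n,\mathbb R): X=-X^t=AXA\}$. $\tilde J$ is the (almost) complex structure on $\mathcal J(\mathbb R^{2n})$ given by $\tilde J X=AX$ for $X\in T_A\mathcal J(\mathbb R^{2n})$. With $\langle X_1,X_2\rangle=\mathrm{tr}(X_1X_2^t)$ for $X_1,X_2\in T_A\mathcal J(\mathbb R^{2n})$, the metric $ds^2$ on $\mathcal J(\mathbb R^{2n})$ is $ds^2(X_1,X_2)=\frac12\langle X_1,X_2\rangle+\frac12\langle \tilde JX_1,\tilde JX_2\rangle$. Its restriction to $\widetilde{\mathcal J}(\mathbb R^{2n})$ is $\mathrm{tr}(X_1X_2^t)$. A Kähler submanifold is a complex submanifold which is Kähler with the induced metric and complex structure. *)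

theory Defs
  imports "HOL-Analysis.Analysis"
begin

section \<open>Embedded submanifolds of a Euclidean space\<close>

text \<open>\<open>Ck_on k f U\<close> is meant for open \<open>U\<close>.  Since the domain is finite-dimensional, \<open>f\<close> is
  \<open>C\<^sup>k\<^sup>+\<^sup>1\<close> iff it is differentiable and all its directional derivatives are \<open>C\<^sup>k\<close>.\<close>

primrec Ck_on :: "nat \<Rightarrow> ('a::euclidean_space \<Rightarrow> 'b::euclidean_space) \<Rightarrow> 'a set \<Rightarrow> bool" where
  "Ck_on 0 f U \<longleftrightarrow> continuous_on U f"
| "Ck_on (Suc k) f U \<longleftrightarrow>
     (\<exists>f'. (\<forall>x\<in>U. (f has_derivative f' x) (at x)) \<and> (\<forall>v. Ck_on k (\<lambda>x. f' x v) U))"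

text \<open>Smoothness on an arbitrary subset (Milnor, Guillemin--Pollack): local extendability to a
  \<open>C\<^sup>\<infinity>\<close> map on an open set of the ambient space.\<close>

definition smooth_map_on :: "'a::euclidean_space set \<Rightarrow> ('a \<Rightarrow> 'b::euclidean_space) \<Rightarrow> bool" where
  "smooth_map_on S f \<longleftrightarrow>
     (\<forall>x\<in>S. \<exists>U F. open U \<and> x \<in> U \<and> (\<forall>k. Ck_on k F U) \<and> (\<forall>y\<in>S \<inter> U. F y = f y))"

definition dir_deriv ::
    "('a::real_normed_vector \<Rightarrow> 'b::real_normed_vector) \<Rightarrow> 'a \<Rightarrow> 'a \<Rightarrow> 'b" where
  "dir_deriv f q v = vector_derivative (\<lambda>t. f (q + t *\<^sub>R v)) (at 0)"

text \<open>The coordinate space is a linear subspace \<open>L\<close> of the ambient space instead of \<open>\<real>\<^sup>d\<close>, so that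
  the dimension need not be a type (and may be zero).\<close>

definition local_parametrization ::
    "'a::euclidean_space set \<Rightarrow> 'a set \<Rightarrow> 'a set \<Rightarrow> ('a \<Rightarrow> 'a) \<Rightarrow> bool" where
  "local_parametrization M L V \<psi> \<longleftrightarrow>
     subspace L \<and> openin (top_of_set L) V \<and> openin (top_of_set M) (\<psi> ` V) \<and>
     inj_on \<psi> V \<and> smooth_map_on V \<psi> \<and> smooth_map_on (\<psi> ` V) (inv_into V \<psi>)"

definition submanifold_dim :: "nat \<Rightarrow> 'a::euclidean_space set \<Rightarrow> bool" where
  "submanifold_dim d M \<longleftrightarrow>
     (\<forall>p\<in>M. \<exists>L V \<psi>. local_parametrization M L V \<psi> \<and> dim L = d \<and> p \<in> \<psi> ` V)"

definition submanifold :: "'a::euclidean_space set \<Rightarrow> bool" where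
  "submanifold M \<longleftrightarrow> (\<exists>d. submanifold_dim d M)"

definition tangent_space :: "'a::euclidean_space set \<Rightarrow> 'a \<Rightarrow> 'a set" where
  "tangent_space M p =
     {v. \<exists>(\<gamma> :: real \<Rightarrow> 'a) e. e > 0 \<and> smooth_map_on {-e<..<e} \<gamma> \<and> \<gamma> ` {-e<..<e} \<subseteq> M \<and>
           \<gamma> 0 = p \<and> (\<gamma> has_vector_derivative v) (at 0)}"

definition vector_field_on :: "'a::euclidean_space set \<Rightarrow> 'a set \<Rightarrow> ('a \<Rightarrow> 'a) \<Rightarrow> bool" where
  "vector_field_on M U X \<longleftrightarrow> smooth_map_on U X \<and> (\<forall>p\<in>U. X p \<in> tangent_space M p)"


section \<open>Complex, Hermitian and Kaehler structures\<close>

text \<open>Tensor fields on \<open>M\<close> are functions of a point and of ambient vectors; only their values at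
  points of \<open>M\<close> and on tangent vectors matter.  Hence the tensor field induced on a submanifold
  \<open>N \<subseteq> M\<close> is given by the same function.\<close>

definition almost_complex_structure ::
    "'a::euclidean_space set \<Rightarrow> ('a \<Rightarrow> 'a \<Rightarrow> 'a) \<Rightarrow> bool" where
  "almost_complex_structure M J \<longleftrightarrow>
     (\<forall>p\<in>M. \<forall>u\<in>tangent_space M p.
        J p u \<in> tangent_space M p \<and> J p (J p u) = - u \<and>
        (\<forall>v\<in>tangent_space M p. \<forall>a b. J p (a *\<^sub>R u + b *\<^sub>R v) = a *\<^sub>R J p u + b *\<^sub>R J p v)) \<and>
     (\<forall>U X. openin (top_of_set M) U \<and> vector_field_on M U X \<longrightarrow>
        smooth_map_on U (\<lambda>p. J p (X p)))"

text \<open>Integrability is expressed by an atlas of holomorphic charts: local parametrizations whose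
  differential intertwines a constant complex structure \<open>j\<close> on the coordinate space with \<open>J\<close>.\<close>

definition complex_manifold ::
    "'a::euclidean_space set \<Rightarrow> ('a \<Rightarrow> 'a \<Rightarrow> 'a) \<Rightarrow> bool" where
  "complex_manifold M J \<longleftrightarrow>
     submanifold M \<and> almost_complex_structure M J \<and>
     (\<forall>p\<in>M. \<exists>L V \<psi> j.
        local_parametrization M L V \<psi> \<and> p \<in> \<psi> ` V \<and>
        linear j \<and> (\<forall>v\<in>L. j v \<in> L \<and> j (j v) = - v) \<and>
        (\<forall>q\<in>V. \<forall>v\<in>L. dir_deriv \<psi> q (j v) = J (\<psi> q) (dir_deriv \<psi> q v)))"

definition riemannian_metric ::
    "'a::euclidean_space set \<Rightarrow> ('a \<Rightarrow> 'a \<Rightarrow> 'a \<Rightarrow> real) \<Rightarrow> bool" where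
  "riemannian_metric M g \<longleftrightarrow>
     (\<forall>p\<in>M. \<forall>u\<in>tangent_space M p.
        (u \<noteq> 0 \<longrightarrow> g p u u > 0) \<and>
        (\<forall>v\<in>tangent_space M p. g p u v = g p v u \<and>
           (\<forall>w\<in>tangent_space M p. \<forall>a b.
              g p (a *\<^sub>R u + b *\<^sub>R v) w = a * g p u w + b * g p v w))) \<and>
     (\<forall>U X Y. openin (top_of_set M) U \<and> vector_field_on M U X \<and> vector_field_on M U Y \<longrightarrow>
        smooth_map_on U (\<lambda>p. g p (X p) (Y p)))"

definition hermitian_manifold ::
    "'a::euclidean_space set \<Rightarrow> ('a \<Rightarrow> 'a \<Rightarrow> 'a \<Rightarrow> real) \<Rightarrow> ('a \<Rightarrow> 'a \<Rightarrow> 'a) \<Rightarrow> bool" where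
  "hermitian_manifold M g J \<longleftrightarrow>
     complex_manifold M J \<and> riemannian_metric M g \<and>
     (\<forall>p\<in>M. \<forall>u\<in>tangent_space M p. \<forall>v\<in>tangent_space M p. g p (J p u) (J p v) = g p u v)"

definition pullback2 ::
    "('a::euclidean_space \<Rightarrow> 'a) \<Rightarrow> ('a \<Rightarrow> 'a \<Rightarrow> 'a \<Rightarrow> real) \<Rightarrow> 'a \<Rightarrow> 'a \<Rightarrow> 'a \<Rightarrow> real" where
  "pullback2 \<psi> \<omega> q u v = \<omega> (\<psi> q) (dir_deriv \<psi> q u) (dir_deriv \<psi> q v)"

text \<open>\<open>d\<omega> = 0\<close>, computed in every local parametrization: for constant vectors \<open>u, v, w\<close> of the
  coordinate space, \<open>d\<omega>(u,v,w) = D\<^sub>u \<omega>(v,w) + D\<^sub>v \<omega>(w,u) + D\<^sub>w \<omega>(u,v)\<close>.\<close>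

definition closed_2form ::
    "'a::euclidean_space set \<Rightarrow> ('a \<Rightarrow> 'a \<Rightarrow> 'a \<Rightarrow> real) \<Rightarrow> bool" where
  "closed_2form M \<omega> \<longleftrightarrow>
     (\<forall>L V \<psi>. local_parametrization M L V \<psi> \<longrightarrow>
        (\<forall>q\<in>V. \<forall>u\<in>L. \<forall>v\<in>L. \<forall>w\<in>L.
           dir_deriv (\<lambda>x. pullback2 \<psi> \<omega> x v w) q u +
           dir_deriv (\<lambda>x. pullback2 \<psi> \<omega> x w u) q v +
           dir_deriv (\<lambda>x. pullback2 \<psi> \<omega> x u v) q w = 0))"

definition fundamental_form ::
    "('a \<Rightarrow> 'a \<Rightarrow> 'a \<Rightarrow> real) \<Rightarrow> ('a \<Rightarrow> 'a \<Rightarrow> 'a) \<Rightarrow> 'a \<Rightarrow> 'a \<Rightarrow> 'a \<Rightarrow> real" where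
  "fundamental_form g J p u v = g p (J p u) v"

definition kaehler_manifold ::
    "'a::euclidean_space set \<Rightarrow> ('a \<Rightarrow> 'a \<Rightarrow> 'a \<Rightarrow> real) \<Rightarrow> ('a \<Rightarrow> 'a \<Rightarrow> 'a) \<Rightarrow> bool" where
  "kaehler_manifold M g J \<longleftrightarrow>
     hermitian_manifold M g J \<and> closed_2form M (fundamental_form g J)"

definition complex_submanifold ::
    "'a::euclidean_space set \<Rightarrow> 'a set \<Rightarrow> ('a \<Rightarrow> 'a \<Rightarrow> 'a) \<Rightarrow> bool" where
  "complex_submanifold N M J \<longleftrightarrow>
     complex_manifold M J \<and> submanifold N \<and> N \<subseteq> M \<and>
     (\<forall>p\<in>N. \<forall>v\<in>tangent_space N p. J p v \<in> tangent_space N p)"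

definition kaehler_submanifold ::
    "'a::euclidean_space set \<Rightarrow> 'a set \<Rightarrow> ('a \<Rightarrow> 'a \<Rightarrow> 'a \<Rightarrow> real) \<Rightarrow> ('a \<Rightarrow> 'a \<Rightarrow> 'a) \<Rightarrow> bool"
  where
  "kaehler_submanifold N M g J \<longleftrightarrow>
     hermitian_manifold M g J \<and> complex_submanifold N M J \<and> kaehler_manifold N g J"


section \<open>Deformation retracts\<close>

text \<open>The homotopy from the identity to the retraction is required to fix \<open>T\<close> pointwise at all
  times.\<close>

definition deformation_retract_of ::
    "'a::topological_space set \<Rightarrow> 'a set \<Rightarrow> bool" where
  "deformation_retract_of T S \<longleftrightarrow>
     (\<exists>r. retraction S T r \<and> homotopic_with_canon (\<lambda>h. \<forall>x\<in>T. h x = x) S S id r)"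


section \<open>The twistor spaces\<close>

definition twistor_space :: "(real^'m^'m) set" where
  "twistor_space = {A. invertible A \<and> A ** A = - mat 1}"

definition orthogonal_twistor_space :: "(real^'m^'m) set" where
  "orthogonal_twistor_space = {A \<in> twistor_space. transpose A = - A}"

definition twistor_J :: "real^'m^'m \<Rightarrow> real^'m^'m \<Rightarrow> real^'m^'m" where
  "twistor_J A X = A ** X"

definition trace_form :: "real^'m^'m \<Rightarrow> real^'m^'m \<Rightarrow> real" where
  "trace_form X Y = trace (X ** transpose Y)"

definition twistor_metric :: "real^'m^'m \<Rightarrow> real^'m^'m \<Rightarrow> real^'m^'m \<Rightarrow> real" where
  "twistor_metric A X Y =
     1/2 * trace_form X Y + 1/2 * trace_form (twistor_J A X) (twistor_J A Y)"

end

theory Submission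
  imports Defs
begin

text \<open>
  Near \<open>A\<close>, both spaces are parametrized by the Cayley transform
  \<open>S \<mapsto> (1 - S)(1 + S)\<^sup>-\<^sup>1A\<close>, where \<open>S\<close> anticommutes with \<open>A\<close> (and is skew in the orthogonal
  case).  The transform is holomorphic when the coordinate space carries the complex structure
  \<open>S \<mapsto> AS\<close>, and its differential at \<open>0\<close> identifies the tangent spaces.

  At a skew \<open>A\<close> the fundamental form is \<open>\<omega>(X, Y) = \<langle>AX, Y\<rangle>\<close>.  In \<open>d\<omega>\<close> the terms with second
  derivatives cancel by symmetry and skewness; what remains is a sum of terms \<open>\<langle>XY, Z\<rangle>\<close>, which vanish
  because conjugation by \<open>A\<close> changes the sign of each of \<open>X\<close>, \<open>Y\<close>, \<open>Z\<close>.

  For the retraction, \<open>H = (1 + A\<^sup>tA)/2\<close> satisfies \<open>A\<^sup>tHA = H\<close>, so that \<open>QAQ\<^sup>-\<^sup>1\<close> is orthogonal whenever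
  \<open>Q\<close> is symmetric and \<open>Q\<^sup>2\<close> is a multiple of \<open>H\<close>.  Replacing \<open>H\<close> by \<open>(1 - s) + sH\<close> gives the homotopy.
\<close>

section \<open>Smooth maps between matrix spaces\<close>

lemma norm_matrix_vector_mult_le: "norm (A *v x) \<le> norm A * norm (x::real^'n)" for A :: "real^'n^'m"
proof -
  have "norm (A *v x) = L2_set (\<lambda>i. norm (A $ i \<bullet> x)) UNIV"
    by (simp add: norm_vec_def matrix_vector_mul_component)
  also have "\<dots> \<le> L2_set (\<lambda>i. norm (A $ i) * norm x) UNIV"
    by (rule L2_set_mono) (simp_all add: Cauchy_Schwarz_ineq2)
  also have "\<dots> = norm A * norm x"
    by (simp add: norm_vec_def[of A] L2_set_left_distrib)
  finally show ?thesis .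
qed

lemma norm_transpose: "norm (transpose A) = norm A" for A :: "real^'n^'m"
proof -
  have "transpose A \<bullet> transpose A = A \<bullet> A"
    unfolding inner_vec_def transpose_def by (simp, rule sum.swap)
  then show ?thesis by (simp add: norm_eq_sqrt_inner)
qed

lemma norm_matrix_matrix_mult_le: "norm (A ** B) \<le> norm A * norm B"
  for A :: "real^'n^'m" and B :: "real^'k^'n"
proof -
  have row: "(A ** B) $ i = transpose B *v (A $ i)" for i
    by (simp add: vec_eq_iff matrix_matrix_mult_def matrix_vector_mult_def transpose_def mult.commute)
  have "norm (A ** B) = L2_set (\<lambda>i. norm (transpose B *v (A $ i))) UNIV"
    by (simp add: norm_vec_def[of "A ** B"] row)
  also have "\<dots> \<le> L2_set (\<lambda>i. norm B * norm (A $ i)) UNIV"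
    by (rule L2_set_mono) (use norm_matrix_vector_mult_le[of "transpose B"] in \<open>simp_all add: norm_transpose\<close>)
  also have "\<dots> = norm A * norm B"
    by (simp add: norm_vec_def[of A] L2_set_right_distrib mult.commute)
  finally show ?thesis .
qed

lemma bounded_bilinear_matrix_matrix_mult:
  "bounded_bilinear ((**) :: real^'n^'m \<Rightarrow> real^'k^'n \<Rightarrow> real^'k^'m)"
proof
  show "\<exists>K. \<forall>(a::real^'n^'m) (b::real^'k^'n). norm (a ** b) \<le> norm a * norm b * K"
    by (intro exI[of _ 1]) (simp add: norm_matrix_matrix_mult_le)
qed (simp_all add: matrix_matrix_mult_def vec_eq_iff sum.distrib sum_distrib_left algebra_simps)

interpretation mmult: bounded_bilinear "(**) :: real^'n^'m \<Rightarrow> real^'k^'n \<Rightarrow> real^'k^'m"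
  by (rule bounded_bilinear_matrix_matrix_mult)

lemma transpose_linear:
  fixes A B :: "real^'n^'m"
  shows "transpose (A + B) = transpose A + transpose B"
    and "transpose (A - B) = transpose A - transpose B"
    and "transpose (- A) = - transpose A"
    and "transpose 0 = (0 :: real^'n^'m)"
  by (simp_all add: transpose_def vec_eq_iff)

lemmas mat_simps = mmult.add_left mmult.add_right mmult.diff_left mmult.diff_right
  mmult.minus_left mmult.minus_right mmult.scaleR_left mmult.scaleR_right
  matrix_mul_assoc[symmetric] matrix_transpose_mul transpose_linear transpose_scalar

lemma matrix_inv_eqs:
  fixes A :: "real^'n^'n"
  assumes "invertible A"
  shows "A ** matrix_inv A = mat 1" "matrix_inv A ** A = mat 1"
    "A ** (matrix_inv A ** X) = X" "matrix_inv A ** (A ** X) = X"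
proof -
  have "\<exists>A'. A ** A' = mat 1 \<and> A' ** A = mat 1"
    using assms by (simp add: invertible_def)
  then have *: "A ** matrix_inv A = mat 1 \<and> matrix_inv A ** A = mat 1"
    unfolding matrix_inv_def by (rule someI_ex)
  then show "A ** matrix_inv A = mat 1" "matrix_inv A ** A = mat 1" by auto
  with * show "A ** (matrix_inv A ** X) = X" "matrix_inv A ** (A ** X) = X"
    by (simp_all add: matrix_mul_assoc)
qed

lemma matrix_inv_unique:
  fixes A :: "real^'n^'n"
  assumes "A ** B = mat 1"
  shows "matrix_inv A = B" "invertible A"
proof -
  show inv: "invertible A" using assms by (auto simp: invertible_right_inverse)
  have "matrix_inv A = matrix_inv A ** (A ** B)" by (simp add: assms)
  then show "matrix_inv A = B" by (simp add: matrix_inv_eqs[OF inv])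
qed

lemma continuous_on_det: "continuous_on S (det :: real^'n^'n \<Rightarrow> real)"
  unfolding det_def by (intro continuous_intros)

lemma open_invertible: "open {A :: real^'n^'n. invertible A}"
proof -
  have "{A :: real^'n^'n. invertible A} = det -` (- {0})"
    by (auto simp: invertible_det_nz)
  then show ?thesis
    by (simp add: open_vimage continuous_on_det open_Compl)
qed

text \<open>By Cramer's rule each entry of the inverse is a quotient of determinants, with nonzero
  denominator on this set.\<close>

lemma continuous_on_matrix_inv: "continuous_on {A :: real^'n^'n. invertible A} matrix_inv"
proof -
  have eq: "matrix_inv A = (\<chi> k j. det (\<chi> i l. if l = k then axis j 1 $ i else A $ i $ l) / det A)"
    if "invertible A" for A :: "real^'n^'n"
  proof -
    have "matrix_inv A *v axis j 1 = (\<chi> k. det (\<chi> i l. if l = k then axis j 1 $ i else A $ i $ l) / det A)" for j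
      using that
      by (subst cramer[symmetric]) (simp_all add: invertible_det_nz[symmetric] matrix_vector_mul_assoc matrix_inv_eqs)
    then have "matrix_inv A $ k $ j = det (\<chi> i l. if l = k then axis j 1 $ i else A $ i $ l) / det A" for j k
      by (simp add: matrix_vector_mult_basis column_def vec_eq_iff)
    then show ?thesis by (simp add: vec_eq_iff)
  qed
  have cont: "continuous_on UNIV (\<lambda>A :: real^'n^'n. (\<chi> i l. if l = k then axis j 1 $ i else A $ i $ l) :: real^'n^'n)" for k j
  proof (intro continuous_on_vec_lambda)
    fix i l show "continuous_on UNIV (\<lambda>A :: real^'n^'n. if l = k then axis j 1 $ i else A $ i $ l)"
      by (cases "l = k") (auto intro!: continuous_intros)
  qed
  have "continuous_on {A. invertible A} (\<lambda>A :: real^'n^'n. (\<chi> k j. det (\<chi> i l. if l = k then axis j 1 $ i else A $ i $ l) / det A) :: real^'n^'n)"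
    by (intro continuous_on_vec_lambda continuous_on_divide continuous_on_det
        continuous_on_compose2[OF continuous_on_det[of UNIV]] continuous_on_subset[OF cont])
      (auto simp: invertible_det_nz)
  then show ?thesis
    by (rule continuous_on_cong[THEN iffD1, rotated -1]) (auto simp: eq)
qed

lemma isCont_matrix_inv: "invertible A \<Longrightarrow> isCont matrix_inv (A :: real^'n^'n)"
  using continuous_on_matrix_inv[where 'n='n] continuous_on_eq_continuous_at[OF open_invertible]
  by blast

text \<open>The remainder factors as \<open>- ((matrix_inv B - ?G) ** ((B - A) ** ?G))\<close>.
  After division by \<open>norm (B - A)\<close> it tends to 0 by continuity of inversion.\<close>

lemma has_derivative_matrix_inv:
  fixes A :: "real^'n^'n"
  assumes A: "invertible A"
  shows "(matrix_inv has_derivative (\<lambda>X. - (matrix_inv A ** X ** matrix_inv A))) (at A)"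
  unfolding has_derivative_iff_norm
proof
  let ?G = "matrix_inv A"
  show "bounded_linear (\<lambda>X. - (?G ** X ** ?G))"
    by (intro bounded_linear_minus bounded_linear_compose[OF mmult.bounded_linear_left]
        mmult.bounded_linear_right)
  have ev: "eventually (\<lambda>B. invertible B) (at A)"
    using open_invertible A by (metis (mono_tags) eventually_at_topological mem_Collect_eq)
  have bnd: "norm (matrix_inv B - ?G - - (?G ** (B - A) ** ?G)) / norm (B - A)
      \<le> norm (matrix_inv B - ?G) * norm ?G" if B: "invertible B" and "B \<noteq> A" for B
  proof -
    have "matrix_inv B - ?G - - (?G ** (B - A) ** ?G) = - ((matrix_inv B - ?G) ** ((B - A) ** ?G))"
      by (simp add: mat_simps matrix_inv_eqs A B)
    then have "norm (matrix_inv B - ?G - - (?G ** (B - A) ** ?G))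
        = norm ((matrix_inv B - ?G) ** ((B - A) ** ?G))"
      by (simp only: norm_minus_cancel)
    also have "\<dots> \<le> norm (matrix_inv B - ?G) * norm ((B - A) ** ?G)"
      by (rule norm_matrix_matrix_mult_le)
    also have "\<dots> \<le> norm (matrix_inv B - ?G) * (norm (B - A) * norm ?G)"
      by (intro mult_left_mono norm_matrix_matrix_mult_le norm_ge_zero)
    finally have "norm (matrix_inv B - ?G - - (?G ** (B - A) ** ?G)) / norm (B - A)
        \<le> (norm (matrix_inv B - ?G) * (norm (B - A) * norm ?G)) / norm (B - A)"
      by (rule divide_right_mono) simp
    also have "\<dots> = norm (matrix_inv B - ?G) * norm ?G" using that by simp
    finally show ?thesis .
  qed
  have "((\<lambda>B. norm (matrix_inv B - ?G) * norm ?G) \<longlongrightarrow> norm (?G - ?G) * norm ?G) (at A)"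
    using isCont_matrix_inv[OF A] unfolding isCont_def by (intro tendsto_intros)
  then have lim: "((\<lambda>B. norm (matrix_inv B - ?G) * norm ?G) \<longlongrightarrow> 0) (at A)" by simp
  show "((\<lambda>B. norm (matrix_inv B - ?G - - (?G ** (B - A) ** ?G)) / norm (B - A)) \<longlongrightarrow> 0) (at A)"
    by (rule Lim_null_comparison[OF _ lim])
      (use ev in \<open>auto simp: eventually_at_filter simp del: diff_minus_eq_add
        elim!: eventually_mono intro!: bnd\<close>)
qed

section \<open>Closure properties of \<open>Ck_on\<close>\<close>

lemma Ck_on_subset: "Ck_on k f U \<Longrightarrow> V \<subseteq> U \<Longrightarrow> Ck_on k f V"
proof (induction k arbitrary: f)
  case 0 then show ?case by (auto intro: continuous_on_subset)
next
  case (Suc k)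
  from Suc.prems(1) obtain f' where
    "\<forall>x\<in>U. (f has_derivative f' x) (at x)" "\<forall>v. Ck_on k (\<lambda>x. f' x v) U"
    unfolding Ck_on.simps(2) by blast
  then show ?case unfolding Ck_on.simps(2)
    using Suc.IH Suc.prems(2) by (intro exI[of _ f']) (auto dest: subsetD)
qed

lemma Ck_on_Suc_imp: "Ck_on (Suc k) f U \<Longrightarrow> Ck_on k f U"
proof (induction k arbitrary: f)
  case 0
  then obtain f' where "\<forall>x\<in>U. (f has_derivative f' x) (at x)"
    unfolding Ck_on.simps(2) by blast
  then show ?case
    by (auto intro!: continuous_at_imp_continuous_on has_derivative_continuous)
next
  case (Suc k)
  then obtain f' where "\<forall>x\<in>U. (f has_derivative f' x) (at x)" "\<forall>v. Ck_on (Suc k) (\<lambda>x. f' x v) U"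
    unfolding Ck_on.simps(2)[of "Suc k"] by blast
  with Suc.IH show ?case unfolding Ck_on.simps(2)[of k] by blast
qed

lemma Ck_on_const: "Ck_on k (\<lambda>x. c) U"
proof (induction k arbitrary: c)
  case (Suc k)
  show ?case unfolding Ck_on.simps(2) by (rule exI[of _ "\<lambda>_ _. 0"]) (simp add: Suc)
qed simp

lemma Ck_on_linear: "linear f \<Longrightarrow> Ck_on k f U"
proof (cases k)
  case (Suc j)
  assume "linear f"
  then have "(f has_derivative f) (at x)" for x
    by (simp add: linear_imp_has_derivative)
  then show ?thesis unfolding Suc Ck_on.simps(2) by (intro exI[of _ "\<lambda>_. f"]) (simp add: Ck_on_const)
qed (simp add: linear_continuous_on linear_conv_bounded_linear)

lemma Ck_on_add: "Ck_on k f U \<Longrightarrow> Ck_on k g U \<Longrightarrow> Ck_on k (\<lambda>x. f x + g x) U"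
proof (induction k arbitrary: f g)
  case 0 then show ?case by (auto intro: continuous_intros)
next
  case (Suc k)
  from Suc.prems obtain f' g' where
    "\<forall>x\<in>U. (f has_derivative f' x) (at x)" "\<forall>v. Ck_on k (\<lambda>x. f' x v) U"
    "\<forall>x\<in>U. (g has_derivative g' x) (at x)" "\<forall>v. Ck_on k (\<lambda>x. g' x v) U"
    unfolding Ck_on.simps(2) by blast
  then show ?case unfolding Ck_on.simps(2)
    by (intro exI[of _ "\<lambda>x v. f' x v + g' x v"]) (auto intro: Suc.IH has_derivative_add)
qed


text \<open>One product rule serves matrix products, scalar multiples and inner products. The
  induction runs over all \<open>f\<close> and \<open>g\<close>, since the derivative pairs each
  factor with a derivative of the other.\<close>

lemma Ck_on_bilinear:
  fixes h :: "'a::euclidean_space \<Rightarrow> 'b::euclidean_space \<Rightarrow> 'c::euclidean_space"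
  assumes h: "bounded_bilinear h"
  shows "Ck_on k f U \<Longrightarrow> Ck_on k g U \<Longrightarrow> Ck_on k (\<lambda>x. h (f x) (g x)) U"
proof (induction k arbitrary: f g)
  case 0 then show ?case by (auto intro: bounded_bilinear.continuous_on[OF h])
next
  case (Suc k)
  from Suc.prems obtain f' g' where *:
    "\<forall>x\<in>U. (f has_derivative f' x) (at x)" "\<forall>v. Ck_on k (\<lambda>x. f' x v) U"
    "\<forall>x\<in>U. (g has_derivative g' x) (at x)" "\<forall>v. Ck_on k (\<lambda>x. g' x v) U"
    unfolding Ck_on.simps(2) by blast
  have "Ck_on k f U" "Ck_on k g U" using Suc.prems by (blast intro: Ck_on_Suc_imp)+
  with * show ?case unfolding Ck_on.simps(2)
    by (intro exI[of _ "\<lambda>x v. h (f x) (g' x v) + h (f' x v) (g x)"])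
      (auto intro!: Suc.IH Ck_on_add bounded_bilinear.FDERIV[OF h])
qed

text \<open>The derivative of the inverse involves only \<open>F'\<close> and the inverse itself,
  undifferentiated. So regularity of order \<open>k\<close> of the inverse, the induction
  hypothesis, gives order \<open>Suc k\<close>.\<close>

lemma Ck_on_matrix_inv:
  fixes F :: "'a::euclidean_space \<Rightarrow> real^'n^'n"
  assumes inv: "\<And>x. x \<in> U \<Longrightarrow> invertible (F x)"
  shows "Ck_on k F U \<Longrightarrow> Ck_on k (\<lambda>x. matrix_inv (F x)) U"
proof (induction k)
  case 0 then show ?case
    using inv by (auto intro!: continuous_on_compose2[OF continuous_on_matrix_inv])
next
  case (Suc k)
  from Suc.prems obtain F' where F':
    "\<forall>x\<in>U. (F has_derivative F' x) (at x)" "\<forall>v. Ck_on k (\<lambda>x. F' x v) U"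
    unfolding Ck_on.simps(2) by blast
  have G: "Ck_on k (\<lambda>x. matrix_inv (F x)) U" using Suc.IH[OF Ck_on_Suc_imp] Suc.prems by blast
  have "((\<lambda>x. matrix_inv (F x)) has_derivative
      (\<lambda>v. - matrix_inv (F x) ** F' x v ** matrix_inv (F x))) (at x)" if "x \<in> U" for x
    using has_derivative_compose[OF F'(1)[rule_format, OF that] has_derivative_matrix_inv[OF inv[OF that]]]
    by (simp add: mmult.minus_left)
  moreover have "Ck_on k (\<lambda>x. - matrix_inv (F x) ** F' x v ** matrix_inv (F x)) U" for v
    using Ck_on_bilinear[OF bounded_bilinear_scaleR Ck_on_const[of k "-1"] G] F'(2)
    by (intro Ck_on_bilinear[OF bounded_bilinear_matrix_matrix_mult] G) simp_all
  ultimately show ?case unfolding Ck_on.simps(2)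
    by (intro exI[of _ "\<lambda>x v. - matrix_inv (F x) ** F' x v ** matrix_inv (F x)"]) simp
qed

section \<open>Smooth maps on arbitrary subsets\<close>

lemma smooth_map_onI:
  "open U \<Longrightarrow> S \<subseteq> U \<Longrightarrow> (\<And>k. Ck_on k f U) \<Longrightarrow> smooth_map_on S f"
  unfolding smooth_map_on_def by blast

lemma smooth_map_on_cong: "smooth_map_on S f \<Longrightarrow> (\<And>x. x \<in> S \<Longrightarrow> f x = g x) \<Longrightarrow> smooth_map_on S g"
  unfolding smooth_map_on_def by (metis IntD1)

lemma smooth_map_on_const: "smooth_map_on S (\<lambda>x. c)"
  by (rule smooth_map_onI[of UNIV]) (auto intro: Ck_on_const)

lemma smooth_map_on_linear: "linear f \<Longrightarrow> smooth_map_on S f"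
  by (rule smooth_map_onI[of UNIV]) (auto intro: Ck_on_linear)

lemma smooth_map_on_bilinear:
  fixes h :: "'a::euclidean_space \<Rightarrow> 'b::euclidean_space \<Rightarrow> 'c::euclidean_space"
  assumes h: "bounded_bilinear h" and f: "smooth_map_on S f" and g: "smooth_map_on S g"
  shows "smooth_map_on S (\<lambda>x. h (f x) (g x))"
  unfolding smooth_map_on_def
proof
  fix x assume "x \<in> S"
  then obtain U F V G where U: "open U" "x \<in> U" "\<forall>k. Ck_on k F U" "\<forall>y\<in>S \<inter> U. F y = f y"
    and V: "open V" "x \<in> V" "\<forall>k. Ck_on k G V" "\<forall>y\<in>S \<inter> V. G y = g y"
    using f g unfolding smooth_map_on_def by metis
  have "Ck_on k (\<lambda>x. h (F x) (G x)) (U \<inter> V)" for k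
    using U V by (intro Ck_on_bilinear[OF h]) (auto intro: Ck_on_subset)
  with U V show "\<exists>U F. open U \<and> x \<in> U \<and> (\<forall>k. Ck_on k F U) \<and> (\<forall>y\<in>S \<inter> U. F y = h (f y) (g y))"
    by (intro exI[of _ "U \<inter> V"] exI[of _ "\<lambda>x. h (F x) (G x)"]) auto
qed

lemmas smooth_map_on_mult = smooth_map_on_bilinear[OF bounded_bilinear_matrix_matrix_mult]

lemma smooth_map_on_add:
  assumes f: "smooth_map_on S f" and g: "smooth_map_on S g"
  shows "smooth_map_on S (\<lambda>x. f x + g x)"
  unfolding smooth_map_on_def
proof
  fix x assume "x \<in> S"
  then obtain U F V G where U: "open U" "x \<in> U" "\<forall>k. Ck_on k F U" "\<forall>y\<in>S \<inter> U. F y = f y"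
    and V: "open V" "x \<in> V" "\<forall>k. Ck_on k G V" "\<forall>y\<in>S \<inter> V. G y = g y"
    using f g unfolding smooth_map_on_def by metis
  have "Ck_on k (\<lambda>x. F x + G x) (U \<inter> V)" for k
    using U V by (intro Ck_on_add) (auto intro: Ck_on_subset)
  with U V show "\<exists>U F. open U \<and> x \<in> U \<and> (\<forall>k. Ck_on k F U) \<and> (\<forall>y\<in>S \<inter> U. F y = f y + g y)"
    by (intro exI[of _ "U \<inter> V"] exI[of _ "\<lambda>x. F x + G x"]) auto
qed

lemma smooth_map_on_diff:
  assumes "smooth_map_on S f" "smooth_map_on S g"
  shows "smooth_map_on S (\<lambda>x. f x - g x)"
  using smooth_map_on_add[OF assms(1)
      smooth_map_on_bilinear[OF bounded_bilinear_scaleR smooth_map_on_const[of S "-1"] assms(2)]]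
  by simp

lemma smooth_map_on_matrix_inv:
  fixes f :: "'a::euclidean_space \<Rightarrow> real^'n^'n"
  assumes f: "smooth_map_on S f" and inv: "\<And>x. x \<in> S \<Longrightarrow> invertible (f x)"
  shows "smooth_map_on S (\<lambda>x. matrix_inv (f x))"
  unfolding smooth_map_on_def
proof
  fix x assume "x \<in> S"
  then obtain U F where U: "open U" "x \<in> U" "\<forall>k. Ck_on k F U" "\<forall>y\<in>S \<inter> U. F y = f y"
    using f unfolding smooth_map_on_def by metis
  \<comment> \<open>The local extension \<open>F\<close> is invertible at the points of
    \<open>S\<close> but perhaps not on all of \<open>U\<close>, so the neighbourhood is cut down to
    the open set where it is.\<close>
  define V where "V = U \<inter> F -` {A. invertible A}"
  have "continuous_on U F" using U(3)[rule_format, of 0] by simp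
  then have "open V"
    unfolding V_def using U(1) open_invertible by (rule continuous_open_preimage)
  moreover have "Ck_on k (\<lambda>x. matrix_inv (F x)) V" for k
    using U(3) by (intro Ck_on_matrix_inv) (auto simp: V_def intro: Ck_on_subset)
  moreover have "x \<in> V" using U \<open>x \<in> S\<close> inv[OF \<open>x \<in> S\<close>] by (auto simp: V_def)
  ultimately show "\<exists>U F. open U \<and> x \<in> U \<and> (\<forall>k. Ck_on k F U) \<and> (\<forall>y\<in>S \<inter> U. F y = matrix_inv (f y))"
    using U(4) by (intro exI[of _ V] exI[of _ "\<lambda>x. matrix_inv (F x)"]) (auto simp: V_def)
qed

section \<open>The Cayley transform\<close>

lemma twistor_space_iff: "A \<in> twistor_space \<longleftrightarrow> A ** A = - mat 1"
proof -
  have "invertible A" if "A ** A = - mat 1"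
    by (rule matrix_inv_unique(2)[of A "- A"]) (simp add: mat_simps that)
  then show ?thesis by (auto simp: twistor_space_def)
qed

lemma twistor_cancel:
  assumes "A \<in> twistor_space"
  shows "A ** A = - mat 1" "A ** (A ** X) = - X"
proof -
  show *: "A ** A = - mat 1" using assms by (simp add: twistor_space_iff)
  have "A ** (A ** X) = (A ** A) ** X" by (rule matrix_mul_assoc)
  then show "A ** (A ** X) = - X" by (simp add: * mmult.minus_left)
qed

text \<open>The tangent space of the twistor space at \<open>A\<close>, and below that of the
  orthogonal one. Both first serve as coordinate spaces of the charts;
  \<open>tangent_space_eq\<close> identifies them with the tangent spaces.\<close>

definition anticommutant :: "real^'m^'m \<Rightarrow> (real^'m^'m) set" where
  "anticommutant A = {X. A ** X = - (X ** A)}"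

definition skew_anticommutant :: "real^'m^'m \<Rightarrow> (real^'m^'m) set" where
  "skew_anticommutant A = {X \<in> anticommutant A. transpose X = - X}"

lemma anticommute_cancel:
  assumes "X \<in> anticommutant A"
  shows "A ** X = - (X ** A)" "A ** (X ** Y) = - (X ** (A ** Y))"
proof -
  show *: "A ** X = - (X ** A)" using assms by (simp add: anticommutant_def)
  have "A ** (X ** Y) = (A ** X) ** Y" by (rule matrix_mul_assoc)
  then show "A ** (X ** Y) = - (X ** (A ** Y))" by (simp add: * mat_simps)
qed

text \<open>When \<open>S\<close> anticommutes with \<open>A\<close> and the inverses exist, this is
  the conjugate \<open>(1 - S) A (1 - S)^-1\<close>.\<close>

definition cayley :: "real^'m^'m \<Rightarrow> real^'m^'m \<Rightarrow> real^'m^'m" where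
  "cayley A S = (mat 1 - S) ** matrix_inv (mat 1 + S) ** A"

text \<open>If \<open>B\<close> is the Cayley image of \<open>S\<close>, then
  \<open>B A = - (1 - S) (1 + S)^-1\<close>; this is the solution for \<open>S\<close>.\<close>

definition cayley_inv :: "real^'m^'m \<Rightarrow> real^'m^'m \<Rightarrow> real^'m^'m" where
  "cayley_inv A B = (mat 1 + B ** A) ** matrix_inv (mat 1 - B ** A)"

lemma matrix_inv_scaleR:
  fixes A :: "real^'n^'n"
  assumes "invertible A" "c \<noteq> 0"
  shows "matrix_inv (c *\<^sub>R A) = (1 / c) *\<^sub>R matrix_inv A" "invertible (c *\<^sub>R A)"
proof -
  have *: "(c *\<^sub>R A) ** ((1 / c) *\<^sub>R matrix_inv A) = mat 1"
    using assms by (simp add: mat_simps matrix_inv_eqs)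
  show "matrix_inv (c *\<^sub>R A) = (1 / c) *\<^sub>R matrix_inv A" "invertible (c *\<^sub>R A)"
    using matrix_inv_unique[OF *] by auto
qed

text \<open>Moving \<open>A\<close> across \<open>S\<close> changes the sign of \<open>S\<close>, so
  \<open>- (A ** ?R ** A)\<close> is an explicit inverse of \<open>1 - S\<close>.\<close>

lemma anticommute_matrix_inv:
  fixes A S :: "real^'m^'m"
  assumes A: "A \<in> twistor_space" and S: "S \<in> anticommutant A" and inv: "invertible (mat 1 + S)"
  shows "invertible (mat 1 - S)" "A ** matrix_inv (mat 1 + S) = matrix_inv (mat 1 - S) ** A"
    "A ** (matrix_inv (mat 1 + S) ** X) = matrix_inv (mat 1 - S) ** (A ** X)"
proof -
  let ?R = "matrix_inv (mat 1 + S)"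
  have "(mat 1 - S) ** (- (A ** ?R ** A)) = - (A ** ((mat 1 + S) ** (?R ** A)))"
    by (simp add: mat_simps anticommute_cancel[OF S])
  also have "\<dots> = mat 1" using inv by (simp add: matrix_inv_eqs twistor_cancel[OF A])
  finally have *: "(mat 1 - S) ** (- (A ** ?R ** A)) = mat 1" .
  show "invertible (mat 1 - S)" by (rule matrix_inv_unique(2)[OF *])
  have "matrix_inv (mat 1 - S) = - (A ** ?R ** A)" by (rule matrix_inv_unique(1)[OF *])
  then show 1: "A ** ?R = matrix_inv (mat 1 - S) ** A"
    by (simp add: mat_simps twistor_cancel[OF A])
  have "A ** (?R ** X) = (A ** ?R) ** X" by (rule matrix_mul_assoc)
  then show "A ** (?R ** X) = matrix_inv (mat 1 - S) ** (A ** X)"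
    by (simp add: 1 matrix_mul_assoc)
qed

lemma matrix_inv_commute:
  fixes A B :: "real^'m^'m"
  assumes "invertible A" "A ** B = B ** A"
  shows "matrix_inv A ** B = B ** matrix_inv A"
proof -
  have "matrix_inv A ** B = matrix_inv A ** (B ** A) ** matrix_inv A"
    using assms(1) by (simp add: mat_simps matrix_inv_eqs)
  also have "\<dots> = B ** matrix_inv A"
    using assms(1) by (simp add: assms(2)[symmetric] mat_simps matrix_inv_eqs)
  finally show ?thesis .
qed

text \<open>In the square, moving the inner \<open>A\<close> to the right exchanges
  \<open>1 - S\<close> with \<open>1 + S\<close>. All factors then cancel in pairs and
  \<open>A ** A\<close> is left.\<close>

lemma cayley_in_twistor_space:
  assumes A: "A \<in> twistor_space" and S: "S \<in> anticommutant A" and inv: "invertible (mat 1 + S)"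
  shows "cayley A S \<in> twistor_space"
proof -
  let ?R = "matrix_inv (mat 1 + S)" and ?R' = "matrix_inv (mat 1 - S)"
  have inv': "invertible (mat 1 - S)" by (rule anticommute_matrix_inv[OF A S inv])
  have AP: "A ** ((mat 1 - S) ** X) = (mat 1 + S) ** (A ** X)" for X
    by (simp add: mat_simps anticommute_cancel[OF S])
  have "cayley A S ** cayley A S = (mat 1 - S) ** (?R ** (A ** ((mat 1 - S) ** (?R ** A))))"
    by (simp add: cayley_def matrix_mul_assoc)
  also have "\<dots> = - mat 1"
    using inv inv' unfolding AP
    by (simp add: matrix_inv_eqs anticommute_matrix_inv[OF A S inv] twistor_cancel[OF A] mat_simps(5,6))
  finally show ?thesis by (simp add: twistor_space_iff)
qed

text \<open>With \<open>?R\<close> the inverse of \<open>1 + S\<close>, these are the difference and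
  the sum of \<open>1 = ?R + S ?R\<close> and \<open>S ?R - ?R\<close>. Their quotient is
  \<open>S\<close>, which is what the inversion of the transform needs.\<close>

lemma cayley_eqs:
  assumes A: "A \<in> twistor_space" and S: "S \<in> anticommutant A" and inv: "invertible (mat 1 + S)"
  shows "mat 1 - cayley A S ** A = 2 *\<^sub>R matrix_inv (mat 1 + S)"
    "mat 1 + cayley A S ** A = 2 *\<^sub>R (S ** matrix_inv (mat 1 + S))"
proof -
  let ?R = "matrix_inv (mat 1 + S)"
  have R: "?R + S ** ?R = mat 1"
    using matrix_inv_eqs(1)[OF inv] by (simp add: mat_simps)
  have CA: "cayley A S ** A = S ** ?R - ?R"
    by (simp add: cayley_def mat_simps twistor_cancel[OF A])
  have "?R + S ** ?R - (S ** ?R - ?R) = 2 *\<^sub>R ?R" "?R + S ** ?R + (S ** ?R - ?R) = 2 *\<^sub>R (S ** ?R)"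
    by (simp_all add: scaleR_2)
  then show "mat 1 - cayley A S ** A = 2 *\<^sub>R ?R" "mat 1 + cayley A S ** A = 2 *\<^sub>R (S ** ?R)"
    unfolding CA R by simp_all
qed

lemma cayley_inv_cayley:
  assumes A: "A \<in> twistor_space" and S: "S \<in> anticommutant A" and inv: "invertible (mat 1 + S)"
  shows "cayley_inv A (cayley A S) = S" "invertible (mat 1 - cayley A S ** A)"
proof -
  have R: "invertible (matrix_inv (mat 1 + S))" "matrix_inv (matrix_inv (mat 1 + S)) = mat 1 + S"
    using matrix_inv_unique[OF matrix_inv_eqs(2)[OF inv]] by auto
  show "invertible (mat 1 - cayley A S ** A)"
    by (simp add: cayley_eqs[OF assms] R matrix_inv_scaleR)
  show "cayley_inv A (cayley A S) = S"
    using inv by (simp add: cayley_inv_def cayley_eqs[OF assms] R matrix_inv_scaleR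
        mmult.scaleR_left mmult.scaleR_right matrix_mul_assoc[symmetric] matrix_inv_eqs)
qed

text \<open>Multiplication on the right by the invertible \<open>?W\<close> (the step
  \<open>cancel\<close>) removes the inverse from every claim and leaves identities between products
  of \<open>A\<close> and \<open>B\<close>.\<close>

lemma cayley_inv_props:
  assumes A: "A \<in> twistor_space" and B: "B \<in> twistor_space" and inv: "invertible (mat 1 - B ** A)"
  shows "cayley_inv A B \<in> anticommutant A" "invertible (mat 1 + cayley_inv A B)"
    "cayley A (cayley_inv A B) = B"
proof -
  let ?S = "cayley_inv A B" and ?W = "mat 1 - B ** A"
  let ?I = "matrix_inv ?W"
  note tw = twistor_cancel[OF A] twistor_cancel[OF B]
  have SW: "?S ** ?W = mat 1 + B ** A" "?S ** (?W ** X) = (mat 1 + B ** A) ** X" for X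
    using inv by (simp_all only: cayley_inv_def matrix_mul_assoc[symmetric] matrix_inv_eqs matrix_mul_rid)
  have cancel: "X = Y" if "X ** ?W = Y ** ?W" for X Y
  proof -
    have "X ** ?W ** ?I = Y ** ?W ** ?I" using that by simp
    then show ?thesis using inv by (simp add: matrix_mul_assoc[symmetric] matrix_inv_eqs del: mmult.diff_left)
  qed
  \<comment> \<open>Both sides equal \<open>A - A B A\<close>, by \<open>A^2 = B^2 = -1\<close>. The
    form on the right puts \<open>?W\<close> next to \<open>?S\<close>, where the product
    \<open>?S ** ?W\<close> is known.\<close>
  have WA: "A ** ?W = - (?W ** (A ** (B ** A)))" by (simp add: mat_simps tw)
  have "A ** ?S = - (?S ** A)"
  proof (rule cancel)
    have "- (?S ** A) ** ?W = ?S ** (?W ** (A ** (B ** A)))"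
      by (simp only: mmult.minus_left matrix_mul_assoc[symmetric] WA mmult.minus_right minus_minus)
    also have "\<dots> = A ** (?S ** ?W)" unfolding SW by (simp add: mat_simps tw)
    finally show "A ** ?S ** ?W = - (?S ** A) ** ?W" by (simp add: matrix_mul_assoc)
  qed
  then show "?S \<in> anticommutant A" by (simp add: anticommutant_def)
  have p: "mat 1 + ?S = 2 *\<^sub>R ?I"
  proof (rule cancel)
    show "(mat 1 + ?S) ** ?W = (2 *\<^sub>R ?I) ** ?W"
      unfolding mmult.add_left SW mmult.scaleR_left using inv by (simp add: matrix_inv_eqs scaleR_2)
  qed
  have m: "mat 1 - ?S = - 2 *\<^sub>R (B ** A ** ?I)"
  proof (rule cancel)
    show "(mat 1 - ?S) ** ?W = (- 2 *\<^sub>R (B ** A ** ?I)) ** ?W"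
      unfolding mmult.diff_left SW mmult.scaleR_left matrix_mul_assoc[symmetric]
      using inv by (simp add: matrix_inv_eqs scaleR_2)
  qed
  have I: "invertible ?I" "matrix_inv ?I = ?W"
    using matrix_inv_unique[OF matrix_inv_eqs(2)[OF inv]] by auto
  show "invertible (mat 1 + ?S)" by (simp add: p I matrix_inv_scaleR)
  show "cayley A ?S = B"
    using inv by (simp add: cayley_def p m I matrix_inv_scaleR mmult.scaleR_left mmult.scaleR_right
        mmult.minus_left mmult.minus_right matrix_mul_assoc[symmetric] matrix_inv_eqs tw del: mmult.diff_left)
qed

text \<open>Transposition turns \<open>1 + S\<close> into \<open>1 - S\<close>, and so does moving
  \<open>A\<close> across it. The two exchanges undo each other, and only the sign from the
  transpose of \<open>A\<close> remains.\<close>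

lemma cayley_skew:
  assumes A: "A \<in> orthogonal_twistor_space" and S: "S \<in> skew_anticommutant A"
    and inv: "invertible (mat 1 + S)"
  shows "cayley A S \<in> orthogonal_twistor_space"
proof -
  have A': "A \<in> twistor_space" "transpose A = - A" and S': "S \<in> anticommutant A" "transpose S = - S"
    using A S by (auto simp: orthogonal_twistor_space_def skew_anticommutant_def)
  note inv' = anticommute_matrix_inv(1)[OF A'(1) S'(1) inv]
  have "transpose (matrix_inv (mat 1 + S)) = matrix_inv (mat 1 - S)"
  proof (rule matrix_inv_unique(1)[symmetric])
    show "(mat 1 - S) ** transpose (matrix_inv (mat 1 + S)) = mat 1"
      using arg_cong[OF matrix_inv_eqs(2)[OF inv], of transpose]
      by (simp add: matrix_transpose_mul transpose_linear S')
  qed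
  then have "transpose (cayley A S) = - (A ** (matrix_inv (mat 1 - S) ** (mat 1 + S)))"
    by (simp add: cayley_def matrix_transpose_mul transpose_linear S' A' mmult.minus_left)
  also have "matrix_inv (mat 1 - S) ** (mat 1 + S) = (mat 1 + S) ** matrix_inv (mat 1 - S)"
    by (rule matrix_inv_commute[OF inv']) (simp add: mat_simps)
  also have "A ** \<dots> = (mat 1 - S) ** (A ** matrix_inv (mat 1 - S))"
    by (simp add: mat_simps anticommute_cancel[OF S'(1)])
  also have "A ** matrix_inv (mat 1 - S) = matrix_inv (mat 1 + S) ** A"
  proof -
    have "A ** matrix_inv (mat 1 + - S) = matrix_inv (mat 1 - - S) ** A"
      using S'(1) inv' by (intro anticommute_matrix_inv(2)[OF A'(1)]) (simp_all add: anticommutant_def mat_simps)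
    then show ?thesis by simp
  qed
  finally have "transpose (cayley A S) = - cayley A S" by (simp add: cayley_def matrix_mul_assoc)
  then show ?thesis
    using cayley_in_twistor_space[OF A'(1) S'(1) inv] by (simp add: orthogonal_twistor_space_def)
qed

lemma cayley_inv_skew:
  assumes A: "A \<in> orthogonal_twistor_space" and B: "B \<in> orthogonal_twistor_space"
    and inv: "invertible (mat 1 - B ** A)"
  shows "cayley_inv A B \<in> skew_anticommutant A"
proof -
  have A': "A \<in> twistor_space" "transpose A = - A" and B': "B \<in> twistor_space" "transpose B = - B"
    using A B by (auto simp: orthogonal_twistor_space_def)
  let ?W = "mat 1 - B ** A" and ?W' = "mat 1 + B ** A"
  let ?I = "matrix_inv ?W"
  note tw = twistor_cancel[OF A'(1)] twistor_cancel[OF B'(1)]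
  have tI: "transpose ?I ** transpose ?W = mat 1"
    using arg_cong[OF matrix_inv_eqs(1)[OF inv], of transpose] by (simp add: matrix_transpose_mul)
  \<comment> \<open>Skewness of \<open>?W' ** ?I\<close> amounts to this identity. Here
    \<open>transpose (B ** A) = A ** B\<close>, and the two products are \<open>A B - B A\<close>
    and \<open>B A - A B\<close>.\<close>
  have key: "transpose ?W' ** ?W = - (transpose ?W ** ?W')"
    by (simp add: mat_simps A' B' tw)
  have "transpose (cayley_inv A B) = transpose ?I ** (transpose ?W' ** (?W ** ?I))"
    using inv by (simp only: cayley_inv_def matrix_transpose_mul matrix_inv_eqs matrix_mul_rid)
  also have "\<dots> = transpose ?I ** ((transpose ?W' ** ?W) ** ?I)"
    by (simp only: matrix_mul_assoc)
  also have "\<dots> = - ((transpose ?I ** transpose ?W) ** (?W' ** ?I))"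
    by (simp only: key mmult.minus_left mmult.minus_right matrix_mul_assoc)
  also have "\<dots> = - cayley_inv A B" by (simp add: tI cayley_inv_def)
  finally show ?thesis
    using cayley_inv_props(1)[OF A'(1) B'(1) inv] by (simp add: skew_anticommutant_def)
qed

section \<open>Charts and tangent spaces\<close>

lemma dir_deriv_eq:
  assumes "(f has_derivative f') (at q)"
  shows "dir_deriv f q v = f' v"
proof -
  have "((\<lambda>t. q + t *\<^sub>R v) has_derivative (\<lambda>t. t *\<^sub>R v)) (at (0::real))"
    by (auto intro!: derivative_eq_intros)
  then have "((\<lambda>t. f (q + t *\<^sub>R v)) has_derivative (\<lambda>t. f' (t *\<^sub>R v))) (at 0)"
    by (rule has_derivative_compose) (use assms in simp)
  moreover have "f' (t *\<^sub>R v) = t *\<^sub>R f' v" for t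
    using has_derivative_linear[OF assms] by (simp add: linear_cmul)
  ultimately have "((\<lambda>t. f (q + t *\<^sub>R v)) has_vector_derivative f' v) (at 0)"
    by (simp add: has_vector_derivative_def)
  then show ?thesis unfolding dir_deriv_def by (rule vector_derivative_at)
qed

lemma trace_form_eq_inner: "trace_form X Y = X \<bullet> Y" for X :: "real^'m^'m"
  by (simp add: trace_form_def trace_def matrix_matrix_mult_def transpose_def inner_vec_def)

lemma twistor_metric_eq: "twistor_metric A X Y = (1/2) * (X \<bullet> Y) + (1/2) * ((A ** X) \<bullet> (A ** Y))"
  by (simp add: twistor_metric_def trace_form_eq_inner twistor_J_def)

lemma smooth_map_on_cayley:
  assumes "smooth_map_on U f" "\<And>x. x \<in> U \<Longrightarrow> invertible (mat 1 + f x)"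
  shows "smooth_map_on U (\<lambda>x. cayley A (f x))"
  unfolding cayley_def
  by (intro smooth_map_on_mult smooth_map_on_diff smooth_map_on_add smooth_map_on_matrix_inv
      smooth_map_on_const assms)

lemma smooth_map_on_cayley_inv:
  assumes "\<And>B. B \<in> U \<Longrightarrow> invertible (mat 1 - B ** A)"
  shows "smooth_map_on U (cayley_inv A)"
proof -
  have "smooth_map_on U (\<lambda>B. B)" by (rule smooth_map_on_linear) (rule linear_id[unfolded id_def])
  then show ?thesis
    unfolding cayley_inv_def[abs_def]
    by (intro smooth_map_on_mult smooth_map_on_diff smooth_map_on_add smooth_map_on_matrix_inv
        smooth_map_on_const assms)
qed

text \<open>The product rule gives \<open>- ((1 - S) R + 1) X R A\<close>, and
  \<open>1 = (1 + S) R\<close> turns the bracket into \<open>2 R\<close>.\<close>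

lemma cayley_has_derivative:
  assumes inv: "invertible (mat 1 + S)"
  defines "R \<equiv> matrix_inv (mat 1 + S)"
  shows "(cayley A has_derivative (\<lambda>X. - 2 *\<^sub>R (R ** X ** R ** A))) (at S)"
proof -
  have p: "((\<lambda>S. mat 1 + S) has_derivative (\<lambda>X. X)) (at S)"
    and m: "((\<lambda>S. mat 1 - S) has_derivative (\<lambda>X. - X)) (at S)"
    by (auto intro!: derivative_eq_intros)
  have i: "((\<lambda>S. matrix_inv (mat 1 + S)) has_derivative (\<lambda>X. - (R ** X ** R))) (at S)"
    unfolding R_def by (rule has_derivative_compose[OF p has_derivative_matrix_inv[OF inv]])
  have "(cayley A has_derivative
      (\<lambda>X. ((mat 1 - S) ** - (R ** X ** R) + - X ** R) ** A)) (at S)"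
    unfolding cayley_def[abs_def]
    using bounded_linear.has_derivative[OF mmult.bounded_linear_left mmult.FDERIV[OF m i]]
    by (simp only: R_def)
  moreover have "((mat 1 - S) ** - (R ** X ** R) + - X ** R) ** A = - 2 *\<^sub>R (R ** X ** R ** A)" for X
  proof -
    have "R + S ** R = mat 1" using matrix_inv_eqs(1)[OF inv] by (simp add: R_def mmult.add_left)
    then have "(R + S ** R) ** (X ** (R ** A)) = X ** (R ** A)" by simp
    then have "X ** (R ** A) = R ** (X ** (R ** A)) + S ** (R ** (X ** (R ** A)))"
      by (simp only: mmult.add_left matrix_mul_assoc[symmetric])
    then have "R ** (X ** (R ** A)) + (S ** (R ** (X ** (R ** A))) - X ** (R ** A)) = 0"
      by (metis add_diff_eq diff_self)
    then show ?thesis by (simp add: mat_simps scaleR_2)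
  qed
  ultimately show ?thesis by simp
qed

text \<open>Up to the factor \<open>-2\<close>, the differential is
  \<open>?R ** X ** ?R ** A\<close>. Multiplying by \<open>cayley A S\<close> on the left brings its
  \<open>A\<close> across \<open>?R\<close> as \<open>?R'\<close>, which cancels
  \<open>1 - S\<close> because \<open>?R\<close> commutes with \<open>1 - S\<close>; what is left
  has \<open>A ** X\<close> in place of \<open>X\<close>.\<close>

lemma cayley_holomorphic:
  assumes A: "A \<in> twistor_space" and S: "S \<in> anticommutant A" and inv: "invertible (mat 1 + S)"
  shows "dir_deriv (cayley A) S (A ** X) = cayley A S ** dir_deriv (cayley A) S X"
proof -
  let ?R = "matrix_inv (mat 1 + S)" and ?R' = "matrix_inv (mat 1 - S)"
  note inv' = anticommute_matrix_inv(1)[OF A S inv]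
  have c1: "?R ** (mat 1 - S) = (mat 1 - S) ** ?R"
    by (rule matrix_inv_commute[OF inv]) (simp add: mat_simps)
  have "cayley A S ** (?R ** X ** ?R ** A) = (mat 1 - S) ** (?R ** (?R' ** (A ** (X ** (?R ** A)))))"
    by (simp add: cayley_def matrix_mul_assoc[symmetric] anticommute_matrix_inv[OF A S inv])
  also have "\<dots> = ((mat 1 - S) ** ?R) ** (?R' ** (A ** (X ** (?R ** A))))"
    by (rule matrix_mul_assoc)
  also have "\<dots> = ?R ** (A ** (X ** (?R ** A)))"
    unfolding c1[symmetric] matrix_mul_assoc[symmetric] by (simp only: matrix_inv_eqs[OF inv'])
  finally show ?thesis
    unfolding dir_deriv_eq[OF cayley_has_derivative[OF inv]]
    by (simp add: mmult.scaleR_right mmult.minus_right matrix_mul_assoc)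
qed

section \<open>Manifolds covered by Cayley charts, a common frame for both twistor spaces\<close>

locale cayley_manifold =
  fixes M :: "(real^'m^'m) set" and T :: "real^'m^'m \<Rightarrow> (real^'m^'m) set"
  assumes twistor: "M \<subseteq> twistor_space"
    and T_subspace: "A \<in> M \<Longrightarrow> subspace (T A)"
    and T_anti: "T A \<subseteq> anticommutant A"
    and T_mult: "A \<in> M \<Longrightarrow> X \<in> T A \<Longrightarrow> A ** X \<in> T A"
    and cayley_mem: "A \<in> M \<Longrightarrow> S \<in> T A \<Longrightarrow> invertible (mat 1 + S) \<Longrightarrow> cayley A S \<in> M"
    and cayley_inv_mem: "A \<in> M \<Longrightarrow> B \<in> M \<Longrightarrow> invertible (mat 1 - B ** A) \<Longrightarrow> cayley_inv A B \<in> T A"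
    and tangent_sub: "A \<in> M \<Longrightarrow> tangent_space M A \<subseteq> T A"
begin

definition chart_dom :: "real^'m^'m \<Rightarrow> (real^'m^'m) set" where
  "chart_dom A = {S \<in> T A. invertible (mat 1 + S)}"

lemma cayley_image:
  assumes "A \<in> M"
  shows "cayley A ` chart_dom A = {B \<in> M. invertible (mat 1 - B ** A)}"
proof (intro equalityI subsetI)
  fix B assume "B \<in> cayley A ` chart_dom A"
  then show "B \<in> {B \<in> M. invertible (mat 1 - B ** A)}"
    using assms twistor T_anti cayley_mem cayley_inv_cayley(2) by (fastforce simp: chart_dom_def)
next
  fix B assume B: "B \<in> {B \<in> M. invertible (mat 1 - B ** A)}"
  then have "A \<in> twistor_space" "B \<in> twistor_space" using assms twistor by auto
  from cayley_inv_props[OF this] B cayley_inv_mem[OF assms, of B]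
  show "B \<in> cayley A ` chart_dom A" by (force simp: chart_dom_def image_iff)
qed

lemma cayley_local_parametrization:
  assumes A: "A \<in> M"
  shows "local_parametrization M (T A) (chart_dom A) (cayley A)" "A \<in> cayley A ` chart_dom A"
proof -
  have A': "A \<in> twistor_space" using A twistor by auto
  have left_inv: "cayley_inv A (cayley A S) = S" if "S \<in> chart_dom A" for S
    using that T_anti[of A] cayley_inv_cayley(1)[OF A'] by (auto simp: chart_dom_def)
  have inj: "inj_on (cayley A) (chart_dom A)" by (rule inj_on_inverseI) (rule left_inv)
  have "open ((\<lambda>S. mat 1 + S) -` {B :: real^'m^'m. invertible B})"
    by (intro open_vimage open_invertible continuous_intros)
  moreover have "chart_dom A = T A \<inter> (\<lambda>S. mat 1 + S) -` {B. invertible B}"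
    by (auto simp: chart_dom_def)
  ultimately have o1: "openin (top_of_set (T A)) (chart_dom A)" by (simp add: openin_open_Int)
  have "open ((\<lambda>B. mat 1 - B ** A) -` {B :: real^'m^'m. invertible B})"
    by (intro open_vimage open_invertible continuous_intros mmult.continuous_on)
  moreover have "cayley A ` chart_dom A = M \<inter> (\<lambda>B. mat 1 - B ** A) -` {B. invertible B}"
    by (auto simp: cayley_image[OF A])
  ultimately have o2: "openin (top_of_set M) (cayley A ` chart_dom A)" by (simp add: openin_open_Int)
  have s1: "smooth_map_on (chart_dom A) (cayley A)"
    by (rule smooth_map_on_cayley[OF smooth_map_on_linear[OF linear_id[unfolded id_def]]])
      (simp add: chart_dom_def)
  have "smooth_map_on (cayley A ` chart_dom A) (cayley_inv A)"
    by (rule smooth_map_on_cayley_inv) (simp add: cayley_image[OF A])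
  then have s2: "smooth_map_on (cayley A ` chart_dom A) (inv_into (chart_dom A) (cayley A))"
    by (rule smooth_map_on_cong) (auto simp: left_inv inj)
  show "local_parametrization M (T A) (chart_dom A) (cayley A)"
    unfolding local_parametrization_def using T_subspace[OF A] o1 o2 inj s1 s2 by blast
  have "matrix_inv (mat 1 :: real^'m^'m) = mat 1" "invertible (mat 1 :: real^'m^'m)"
    using matrix_inv_unique[of "mat 1 :: real^'m^'m" "mat 1"] by auto
  then have "cayley A 0 = A" "0 \<in> chart_dom A"
    using T_subspace[OF A] by (simp_all add: cayley_def chart_dom_def subspace_0)
  then show "A \<in> cayley A ` chart_dom A" by force
qed

text \<open>One inclusion is \<open>tangent_sub\<close>. Conversely, every \<open>X\<close> is the
  velocity at 0 of a Cayley curve \<open>cayley A (t *\<^sub>R S)\<close>, which stays in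
  \<open>M\<close>.\<close>

lemma tangent_space_eq:
  assumes A: "A \<in> M"
  shows "tangent_space M A = T A"
proof (rule equalityI[OF tangent_sub[OF A]], rule subsetI)
  fix X assume X: "X \<in> T A"
  have A': "A \<in> twistor_space" using A twistor by auto
  have X': "X \<in> anticommutant A" using X T_anti by auto
  \<comment> \<open>The differential of \<open>cayley A\<close> at 0 sends \<open>S\<close> to
    \<open>- 2 S A\<close>; this \<open>S\<close> is the preimage of \<open>X\<close>, since
    \<open>X\<close> anticommutes with \<open>A\<close>.\<close>
  define S where "S = (-1/2) *\<^sub>R (A ** X)"
  have S: "t *\<^sub>R S \<in> T A" for t
    unfolding S_def by (intro subspace_scale[OF T_subspace[OF A]] T_mult[OF A X])
  have "open ((\<lambda>t. mat 1 + t *\<^sub>R S) -` {B :: real^'m^'m. invertible B})"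
    by (intro open_vimage open_invertible continuous_intros)
  moreover have inv1: "matrix_inv (mat 1 :: real^'m^'m) = mat 1" "invertible (mat 1 :: real^'m^'m)"
    using matrix_inv_unique[of "mat 1 :: real^'m^'m" "mat 1"] by auto
  ultimately obtain e where e: "e > 0" "ball 0 e \<subseteq> (\<lambda>t. mat 1 + t *\<^sub>R S) -` {B. invertible B}"
    by (metis (mono_tags, lifting) add.right_neutral mem_Collect_eq openE scaleR_zero_left vimageI)
  then have inv: "invertible (mat 1 + t *\<^sub>R S)" if "t \<in> {-e<..<e}" for t
    using that by (auto simp: subset_iff dist_real_def)
  let ?g = "\<lambda>t. cayley A (t *\<^sub>R S)"
  have sm: "smooth_map_on {-e<..<e} ?g"
    by (intro smooth_map_on_cayley smooth_map_on_linear inv linear_scaleR_left) auto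
  have im: "?g ` {-e<..<e} \<subseteq> M" using cayley_mem[OF A S] inv by auto
  have g0: "?g 0 = A" by (simp add: cayley_def inv1)
  have "(?g has_derivative (\<lambda>t. - 2 *\<^sub>R (matrix_inv (mat 1 + 0) ** (t *\<^sub>R S) ** matrix_inv (mat 1 + 0) ** A))) (at 0)"
    by (rule has_derivative_compose[where g = "cayley A"])
      (use cayley_has_derivative[of 0 A] inv1 in \<open>auto intro!: derivative_eq_intros\<close>)
  moreover have "- 2 *\<^sub>R (matrix_inv (mat 1 + 0) ** (t *\<^sub>R S) ** matrix_inv (mat 1 + 0) ** A) = t *\<^sub>R X" for t
    by (simp add: inv1 S_def mat_simps anticommute_cancel[OF X'] twistor_cancel[OF A'])
  ultimately have "(?g has_vector_derivative X) (at 0)" by (simp add: has_vector_derivative_def)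
  then show "X \<in> tangent_space M A" unfolding tangent_space_def using e(1) sm im g0 by blast
qed

lemma almost_complex: "almost_complex_structure M twistor_J"
  unfolding almost_complex_structure_def twistor_J_def
proof (intro conjI ballI allI impI)
  fix A X assume A: "A \<in> M" and X: "X \<in> tangent_space M A"
  show "A ** X \<in> tangent_space M A" using A X by (simp add: tangent_space_eq T_mult)
  show "A ** (A ** X) = - X" using A twistor twistor_cancel by auto
next
  fix U X assume *: "openin (top_of_set M) U \<and> vector_field_on M U X"
  have "smooth_map_on U (\<lambda>p. p)" by (rule smooth_map_on_linear) (rule linear_id[unfolded id_def])
  then show "smooth_map_on U (\<lambda>p. p ** X p)"
    using * by (intro smooth_map_on_mult) (auto simp: vector_field_on_def)
qed (simp add: mmult.add_right mmult.scaleR_right)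

lemma riemannian: "riemannian_metric M twistor_metric"
  unfolding riemannian_metric_def twistor_metric_eq
proof (intro conjI ballI allI impI)
  fix A X :: "real^'m^'m" assume "X \<noteq> 0"
  then show "0 < 1 / 2 * (X \<bullet> X) + 1 / 2 * ((A ** X) \<bullet> (A ** X))"
    by (simp add: add_pos_nonneg)
next
  fix U X Y assume *: "openin (top_of_set M) U \<and> vector_field_on M U X \<and> vector_field_on M U Y"
  have "smooth_map_on U (\<lambda>p. p)" by (rule smooth_map_on_linear) (rule linear_id[unfolded id_def])
  with * have "smooth_map_on U (\<lambda>p. p ** X p)" "smooth_map_on U (\<lambda>p. p ** Y p)"
    "smooth_map_on U X" "smooth_map_on U Y"
    by (auto intro!: smooth_map_on_mult simp: vector_field_on_def)
  then show "smooth_map_on U (\<lambda>p. 1 / 2 * (X p \<bullet> Y p) + 1 / 2 * ((p ** X p) \<bullet> (p ** Y p)))"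
    by (intro smooth_map_on_add smooth_map_on_bilinear[OF bounded_bilinear_mult]
        smooth_map_on_bilinear[OF bounded_bilinear_inner] smooth_map_on_const)
qed (simp_all add: inner_commute mmult.add_right mmult.scaleR_right inner_add_left algebra_simps)

lemma complex:
  assumes "submanifold M"
  shows "complex_manifold M twistor_J"
  unfolding complex_manifold_def
proof (intro conjI ballI assms almost_complex)
  fix A assume A: "A \<in> M"
  have A': "A \<in> twistor_space" using A twistor by auto
  have "dir_deriv (cayley A) q (A ** v) = twistor_J (cayley A q) (dir_deriv (cayley A) q v)"
    if "q \<in> chart_dom A" for q v
    unfolding twistor_J_def using that T_anti[of A]
    by (intro cayley_holomorphic[OF A']) (auto simp: chart_dom_def)
  then show "\<exists>L V \<psi> j. local_parametrization M L V \<psi> \<and> A \<in> \<psi> ` V \<and> linear j \<and>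
      (\<forall>v\<in>L. j v \<in> L \<and> j (j v) = - v) \<and>
      (\<forall>q\<in>V. \<forall>v\<in>L. dir_deriv \<psi> q (j v) = twistor_J (\<psi> q) (dir_deriv \<psi> q v))"
    using cayley_local_parametrization[OF A] T_mult[OF A] twistor_cancel(2)[OF A']
      mmult.bounded_linear_right[of A, THEN bounded_linear.linear]
    by (intro exI[of _ "T A"] exI[of _ "chart_dom A"] exI[of _ "cayley A"] exI[of _ "(**) A"]) blast
qed

text \<open>Since \<open>twistor_J\<close> squares to \<open>-1\<close>, applying it to both
  arguments just exchanges the two halves of the metric.\<close>

lemma hermitian:
  assumes "submanifold M"
  shows "hermitian_manifold M twistor_metric twistor_J"
  unfolding hermitian_manifold_def
proof (intro conjI ballI complex[OF assms] riemannian)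
  fix A X Y assume "A \<in> M"
  then have "A \<in> twistor_space" using twistor by auto
  then show "twistor_metric A (twistor_J A X) (twistor_J A Y) = twistor_metric A X Y"
    by (simp add: twistor_metric_eq twistor_J_def twistor_cancel)
qed

text \<open>The coordinate space \<open>T A\<close> varies with the base point, so constancy of its
  dimension is an assumption here; trace formulas supply it later.\<close>

lemma submanifold_dim:
  assumes "\<And>A. A \<in> M \<Longrightarrow> dim (T A) = d"
  shows "submanifold_dim d M"
  unfolding submanifold_dim_def using cayley_local_parametrization assms by blast

end

section \<open>Upper bounds for the tangent spaces, by differentiating the defining equations along
  curves\<close>

lemma tangent_twistor_space: "tangent_space twistor_space A \<subseteq> anticommutant A"
proof
  fix X assume "X \<in> tangent_space twistor_space A"
  then obtain g e where g: "e > 0" "g ` {-e<..<e} \<subseteq> twistor_space" "g 0 = A"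
    "(g has_vector_derivative X) (at (0::real))"
    unfolding tangent_space_def by blast
  then have "((\<lambda>t. g t ** g t) has_vector_derivative A ** X + X ** A) (at 0)"
    using mmult.has_vector_derivative[OF g(4,4)] by simp
  moreover have "((\<lambda>t. g t ** g t) has_vector_derivative 0) (at 0)"
  proof (rule has_vector_derivative_transform_within_open[OF has_vector_derivative_const, where S = "{-e<..<e}"])
    show "- mat 1 = g t ** g t" if "t \<in> {-e<..<e}" for t
      using g(2) that twistor_cancel(1)[of "g t"] by (auto simp: image_subset_iff)
  qed (use g(1) in auto)
  ultimately have "A ** X + X ** A = 0" by (rule vector_derivative_unique_at)
  then show "X \<in> anticommutant A" by (simp add: anticommutant_def eq_neg_iff_add_eq_0)
qed

lemma linear_transpose: "linear (transpose :: real^'n^'m \<Rightarrow> real^'m^'n)"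
  by (rule linearI) (simp_all add: transpose_linear transpose_scalar)

lemma tangent_orthogonal_twistor_space:
  "tangent_space orthogonal_twistor_space A \<subseteq> skew_anticommutant A"
proof
  fix X assume X: "X \<in> tangent_space orthogonal_twistor_space A"
  then obtain g e where g: "e > 0" "g ` {-e<..<e} \<subseteq> orthogonal_twistor_space" "g 0 = A"
    "(g has_vector_derivative X) (at (0::real))"
    unfolding tangent_space_def by blast
  have "((\<lambda>t. transpose (g t)) has_vector_derivative transpose X) (at 0)"
    using bounded_linear.has_vector_derivative[OF _ g(4)] linear_transpose linear_conv_bounded_linear
    by blast
  moreover have "((\<lambda>t. transpose (g t)) has_vector_derivative - X) (at 0)"
  proof (rule has_vector_derivative_transform_within_open[OF has_vector_derivative_minus[OF g(4)], of "{-e<..<e}"])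
    show "- g t = transpose (g t)" if "t \<in> {-e<..<e}" for t
      using g(2) that by (auto simp: image_subset_iff orthogonal_twistor_space_def)
  qed (use g(1) in auto)
  ultimately have "transpose X = - X" by (rule vector_derivative_unique_at)
  moreover have "X \<in> tangent_space twistor_space A"
    using X unfolding tangent_space_def orthogonal_twistor_space_def by fast
  ultimately show "X \<in> skew_anticommutant A"
    using tangent_twistor_space by (auto simp: skew_anticommutant_def)
qed

lemma subspace_anticommutant: "subspace (anticommutant A)"
  by (auto simp: subspace_def anticommutant_def mat_simps)

lemma subspace_skew_anticommutant: "subspace (skew_anticommutant A)"
  using subspace_anticommutant[of A]
  by (auto simp: subspace_def skew_anticommutant_def mat_simps)

lemma mult_anticommutant:
  "A \<in> twistor_space \<Longrightarrow> X \<in> anticommutant A \<Longrightarrow> A ** X \<in> anticommutant A"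
  unfolding anticommutant_def[of A] mem_Collect_eq
  by (simp add: anticommute_cancel(2)[unfolded anticommutant_def mem_Collect_eq] mat_simps twistor_cancel)

lemma mult_skew_anticommutant:
  assumes "A \<in> orthogonal_twistor_space" "X \<in> skew_anticommutant A"
  shows "A ** X \<in> skew_anticommutant A"
proof -
  have "A ** X \<in> anticommutant A"
    using assms by (intro mult_anticommutant) (auto simp: orthogonal_twistor_space_def skew_anticommutant_def)
  moreover have "transpose (A ** X) = X ** A"
    using assms by (auto simp: orthogonal_twistor_space_def skew_anticommutant_def mat_simps)
  ultimately show ?thesis using assms(2) by (simp add: skew_anticommutant_def anticommutant_def)
qed

interpretation twistor: cayley_manifold twistor_space anticommutant
  using subspace_anticommutant cayley_in_twistor_space cayley_inv_props(1) tangent_twistor_space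
    mult_anticommutant
  by unfold_locales blast+

interpretation orthogonal_twistor: cayley_manifold orthogonal_twistor_space skew_anticommutant
proof
  show "orthogonal_twistor_space \<subseteq> twistor_space" by (auto simp: orthogonal_twistor_space_def)
  show "skew_anticommutant A \<subseteq> anticommutant A" for A by (auto simp: skew_anticommutant_def)
qed (use subspace_skew_anticommutant cayley_skew cayley_inv_skew tangent_orthogonal_twistor_space
  mult_skew_anticommutant in blast)+

section \<open>The deformation retraction\<close>

definition op_bounded :: "real \<Rightarrow> real^'m^'m \<Rightarrow> bool" where
  "op_bounded c A \<longleftrightarrow> transpose A = A \<and> (\<forall>x. norm (A *v x) \<le> c * norm x)"

lemma continuous_on_matrix_vector_left: "continuous_on S (\<lambda>A :: real^'n^'m. A *v x)"
proof -
  have "linear (\<lambda>A :: real^'n^'m. A *v x)"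
    by (rule linearI) (simp_all add: matrix_vector_mult_add_rdistrib scaleR_matrix_vector_assoc)
  then show ?thesis by (simp add: linear_continuous_on linear_conv_bounded_linear)
qed

text \<open>Brouwer's theorem and the closed graph argument both take place on this set. Each entry
  is a component of the image of a unit vector, hence at most \<open>c\<close>; closedness is clear
  from the pointwise inequalities.\<close>

lemma compact_op_bounded: "compact {A :: real^'m^'m. op_bounded c A}"
proof -
  have "norm A \<le> (\<Sum>i\<in>(UNIV::'m set). \<Sum>j\<in>(UNIV::'m set). c)" if "op_bounded c A" for A :: "real^'m^'m"
  proof -
    have "norm (A $ i) \<le> (\<Sum>j\<in>(UNIV::'m set). c)" for i
    proof -
      have "norm (A $ i $ j) \<le> c" for j
      proof -
        have "\<bar>A $ i $ j\<bar> = \<bar>(A *v axis j 1) $ i\<bar>"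
          by (simp add: matrix_vector_mult_basis column_def)
        also have "\<dots> \<le> norm (A *v axis j 1)" by (rule component_le_norm_cart)
        also have "\<dots> \<le> c * norm (axis j 1 :: real^'m)" using that by (simp only: op_bounded_def)
        finally show ?thesis by (simp add: norm_axis_1)
      qed
      then show ?thesis
        by (intro order_trans[OF norm_le_l1_cart] sum_mono) auto
    qed
    then have "L2_set (\<lambda>i. norm (A $ i)) UNIV \<le> (\<Sum>i\<in>(UNIV::'m set). \<Sum>j\<in>(UNIV::'m set). c)"
      by (intro order_trans[OF L2_set_le_sum] sum_mono) auto
    then show ?thesis by (simp add: norm_vec_def)
  qed
  then have "bounded {A :: real^'m^'m. op_bounded c A}" unfolding bounded_iff by blast
  moreover have "closed {A :: real^'m^'m. op_bounded c A}"
    unfolding op_bounded_def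
    by (intro closed_Collect_conj closed_Collect_all closed_Collect_eq closed_Collect_le
        continuous_intros continuous_on_matrix_vector_left linear_continuous_on
        linear_conv_bounded_linear[THEN iffD1] linear_transpose)
  ultimately show ?thesis by (simp add: compact_eq_bounded_closed)
qed

lemma convex_op_bounded: "convex {A :: real^'m^'m. op_bounded c A}"
proof (rule convexI)
  fix A B :: "real^'m^'m" and u v :: real
  assume A: "A \<in> {A. op_bounded c A}" and B: "B \<in> {A. op_bounded c A}" and uv: "0 \<le> u" "0 \<le> v" "u + v = 1"
  have "norm ((u *\<^sub>R A + v *\<^sub>R B) *v x) \<le> c * norm x" for x
  proof -
    have "norm ((u *\<^sub>R A + v *\<^sub>R B) *v x) \<le> u * norm (A *v x) + v * norm (B *v x)"
      using norm_triangle_ineq[of "u *\<^sub>R (A *v x)" "v *\<^sub>R (B *v x)"] uv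
      by (simp add: matrix_vector_mult_add_rdistrib scaleR_matrix_vector_assoc[symmetric])
    also have "\<dots> \<le> u * (c * norm x) + v * (c * norm x)"
      using A B uv by (intro add_mono mult_left_mono) (auto simp: op_bounded_def)
    also have "\<dots> = c * norm x" using uv(3) by (simp add: distrib_right[symmetric])
    finally show ?thesis .
  qed
  then show "u *\<^sub>R A + v *\<^sub>R B \<in> {A. op_bounded c A}"
    using A B by (simp add: op_bounded_def transpose_linear transpose_scalar)
qed

lemma op_bounded_mono: "op_bounded c A \<Longrightarrow> c \<le> d \<Longrightarrow> op_bounded d A"
  unfolding op_bounded_def by (meson mult_right_mono norm_ge_zero order_trans)

text \<open>\<open>root_eq C Y\<close> says \<open>(1 - Y)\<^sup>2 = 1 - C\<close>, written as a fixed point equation: for a contraction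
  \<open>C\<close> the right-hand side preserves the compact convex set of symmetric \<open>Y\<close> with the same bound, so
  Brouwer's theorem gives a solution.\<close>

definition root_eq :: "real^'m^'m \<Rightarrow> real^'m^'m \<Rightarrow> bool" where
  "root_eq C Y \<longleftrightarrow> Y = (1/2) *\<^sub>R (C + Y ** Y)"

lemma root_eq_exists:
  fixes C :: "real^'m^'m"
  assumes C: "op_bounded c C" and c: "0 \<le> c" "c < 1"
  obtains Y where "op_bounded c Y" "root_eq C Y"
proof -
  let ?K = "{A :: real^'m^'m. op_bounded c A}"
  let ?f = "\<lambda>Y. (1/2) *\<^sub>R (C + Y ** Y)"
  have "?f Y \<in> ?K" if "Y \<in> ?K" for Y
  proof -
    have Y: "transpose Y = Y" "\<And>x. norm (Y *v x) \<le> c * norm x" using that by (auto simp: op_bounded_def)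
    have "norm (?f Y *v x) \<le> c * norm x" for x
    proof -
      have "norm (Y *v (Y *v x)) \<le> c * (c * norm x)"
        by (rule order_trans[OF Y(2)]) (use Y(2) c in \<open>intro mult_left_mono\<close>)
      also have "\<dots> \<le> 1 * (c * norm x)" using c by (intro mult_right_mono) auto
      finally have 1: "norm (Y *v (Y *v x)) \<le> c * norm x" by simp
      have "?f Y *v x = (1/2) *\<^sub>R (C *v x + Y *v (Y *v x))"
        by (simp add: scaleR_matrix_vector_assoc[symmetric] matrix_vector_mult_add_rdistrib matrix_vector_mul_assoc)
      then have "norm (?f Y *v x) = (1/2) * norm (C *v x + Y *v (Y *v x))" by simp
      also have "\<dots> \<le> (1/2) * (c * norm x + c * norm x)"
        using C 1 by (intro mult_left_mono order_trans[OF norm_triangle_ineq] add_mono) (auto simp: op_bounded_def)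
      finally show ?thesis by simp
    qed
    then show ?thesis using Y C by (simp add: op_bounded_def mat_simps)
  qed
  moreover have "continuous_on ?K ?f" by (intro continuous_intros mmult.continuous_on)
  moreover have "(0 :: real^'m^'m) \<in> ?K" using c by (simp add: op_bounded_def transpose_linear)
  ultimately obtain Y where "Y \<in> ?K" "?f Y = Y"
    using brouwer[OF compact_op_bounded convex_op_bounded, of c ?f] by blast
  then show ?thesis using that by (simp add: root_eq_def)
qed

text \<open>The difference satisfies \<open>?D = (Y ?D + ?D Z) / 2\<close>, so its operator norm
  \<open>b\<close> satisfies \<open>b \<le> c * b\<close>, which forces
  \<open>b = 0\<close>.\<close>

lemma root_eq_unique:
  fixes C :: "real^'m^'m"
  assumes Y: "op_bounded c Y" "root_eq C Y" and Z: "op_bounded c Z" "root_eq C Z" and c: "c < 1"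
  shows "Y = Z"
proof -
  let ?D = "Y - Z"
  define b where "b = onorm ((*v) ?D)"
  have b: "norm (?D *v x) \<le> b * norm x" for x unfolding b_def by (intro onorm matrix_vector_mul_bounded_linear)
  have b0: "0 \<le> b" unfolding b_def by (intro onorm_pos_le matrix_vector_mul_bounded_linear)
  have Yc: "norm (Y *v x) \<le> c * norm x" and Zc: "norm (Z *v x) \<le> c * norm x" for x
    using Y Z by (auto simp: op_bounded_def)
  \<comment> \<open>Any unit vector will do: it shows that the bound \<open>c\<close> is
    nonnegative.\<close>
  have "norm (axis undefined 1 :: real^'m) = 1" by (simp add: norm_axis_1)
  then have c0: "0 \<le> c" using Yc[of "axis undefined 1"] by (metis mult.right_neutral norm_ge_zero order_trans)
  have D: "?D = (1/2) *\<^sub>R (Y ** ?D + ?D ** Z)"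
  proof -
    have "?D = (1/2) *\<^sub>R (C + Y ** Y) - (1/2) *\<^sub>R (C + Z ** Z)"
      using Y(2) Z(2) unfolding root_eq_def by (rule arg_cong2)
    also have "\<dots> = (1/2) *\<^sub>R (Y ** Y - Z ** Z)" by (simp add: scaleR_diff_right scaleR_add_right)
    also have "Y ** Y - Z ** Z = Y ** ?D + ?D ** Z" by (simp add: mat_simps)
    finally show ?thesis .
  qed
  have "norm (?D *v x) \<le> (c * b) * norm x" for x
  proof -
    have "?D *v x = (1/2) *\<^sub>R (Y *v (?D *v x) + ?D *v (Z *v x))"
      by (subst D) (simp add: scaleR_matrix_vector_assoc[symmetric] matrix_vector_mult_add_rdistrib matrix_vector_mul_assoc)
    then have "norm (?D *v x) = norm ((1/2) *\<^sub>R (Y *v (?D *v x) + ?D *v (Z *v x)))" by (rule arg_cong)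
    also have "\<dots> = (1/2) * norm (Y *v (?D *v x) + ?D *v (Z *v x))" by simp
    also have "\<dots> \<le> (1/2) * (c * (b * norm x) + b * (c * norm x))"
    proof (intro mult_left_mono order_trans[OF norm_triangle_ineq] add_mono)
      show "norm (Y *v (?D *v x)) \<le> c * (b * norm x)"
        by (rule order_trans[OF Yc]) (intro mult_left_mono b c0)
      show "norm (?D *v (Z *v x)) \<le> b * (c * norm x)"
        by (rule order_trans[OF b]) (intro mult_left_mono Zc b0)
    qed simp
    finally show ?thesis by (simp add: algebra_simps)
  qed
  then have "b \<le> c * b" unfolding b_def by (intro onorm_le) (simp add: b_def)
  then have "(1 - c) * b \<le> 0" by (simp add: algebra_simps)
  with c b0 have "b = 0" by (simp add: mult_le_0_iff)
  then have "?D *v x = 0" for x using b[of x] by simp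
  then have "?D = 0" by (metis matrix_eq matrix_vector_mult_0)
  then show ?thesis by simp
qed

text \<open>This is \<open>1 - sqrt (1 - C)\<close>. The bound below 1 makes \<open>1 - Y\<close>
  positive definite and thus singles out the positive square root.\<close>

definition mat_root :: "real^'m^'m \<Rightarrow> real^'m^'m" where
  "mat_root C = (SOME Y. (\<exists>c<1. op_bounded c Y) \<and> root_eq C Y)"

lemma mat_root_eqI:
  assumes "op_bounded c Y" "c < 1" "root_eq C Y"
  shows "mat_root C = Y"
proof -
  have "(\<exists>c<1. op_bounded c (mat_root C)) \<and> root_eq C (mat_root C)"
    unfolding mat_root_def by (rule someI[of _ Y]) (use assms in blast)
  then obtain d where d: "d < 1" "op_bounded d (mat_root C)" "root_eq C (mat_root C)" by blast
  \<comment> \<open>The two solutions come with different bounds; uniqueness applies with the larger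
    one, still below 1.\<close>
  show ?thesis
    by (rule root_eq_unique[of "max c d"]) (use assms d in \<open>auto intro: op_bounded_mono\<close>)
qed

lemma mat_root_props:
  assumes "op_bounded c C" "0 \<le> c" "c < 1"
  shows "op_bounded c (mat_root C)" "root_eq C (mat_root C)"
proof -
  obtain Y where "op_bounded c Y" "root_eq C Y" by (rule root_eq_exists[OF assms])
  moreover from this have "mat_root C = Y" using assms(3) by (intro mat_root_eqI)
  ultimately show "op_bounded c (mat_root C)" "root_eq C (mat_root C)" by simp_all
qed

text \<open>By uniqueness of the solution, the graph of \<open>mat_root\<close> is closed.\<close>

lemma continuous_on_mat_root:
  assumes c: "0 \<le> c" "c < 1"
  shows "continuous_on {C :: real^'m^'m. op_bounded c C} mat_root"
proof (rule continuous_from_closed_graph[OF compact_op_bounded[of c]])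
  let ?K = "{C :: real^'m^'m. op_bounded c C}"
  show "mat_root \<in> ?K \<rightarrow> ?K" using mat_root_props[OF _ c] by auto
  have "(\<lambda>C. (C, mat_root C)) ` ?K = {p \<in> ?K \<times> ?K. snd p = (1/2) *\<^sub>R (fst p + snd p ** snd p)}"
    using mat_root_props[OF _ c] mat_root_eqI[OF _ c(2)] by (fastforce simp: root_eq_def image_iff)
  moreover have "closed {p :: (real^'m^'m) \<times> (real^'m^'m). snd p = (1/2) *\<^sub>R (fst p + snd p ** snd p)}"
    by (intro closed_Collect_eq continuous_intros mmult.continuous_on)
  ultimately show "closed ((\<lambda>C. (C, mat_root C)) ` ?K)"
    by (simp add: Collect_conj_eq closed_Int closed_Times compact_imp_closed[OF compact_op_bounded])
qed

lemma root_eq_square: "root_eq C Y \<Longrightarrow> (mat 1 - Y) ** (mat 1 - Y) = mat 1 - C"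
proof -
  assume "root_eq C Y"
  then have "2 *\<^sub>R Y = 2 *\<^sub>R ((1/2) *\<^sub>R (C + Y ** Y))" unfolding root_eq_def by simp
  then have "Y + Y = C + Y ** Y" by (simp add: scaleR_2)
  then show ?thesis by (simp add: mat_simps algebra_simps)
qed

lemma op_bounded_invertible:
  assumes "op_bounded c Y" "c < 1"
  shows "invertible (mat 1 - Y)"
proof -
  have "x = 0" if "(mat 1 - Y) *v x = 0" for x
  proof -
    have "Y *v x = x" using that by (simp add: matrix_vector_mult_diff_rdistrib)
    then have "norm x \<le> c * norm x" using assms by (metis op_bounded_def)
    then show ?thesis using assms(2) by (metis mult_le_cancel_right1 norm_le_zero_iff not_le)
  qed
  then show ?thesis by (simp add: invertible_left_inverse matrix_left_invertible_ker)
qed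

section \<open>Conjugation by square roots of an interpolated invariant form\<close>

definition polar_form :: "real \<Rightarrow> real^'m^'m \<Rightarrow> real^'m^'m" where
  "polar_form s A = (1 - s/2) *\<^sub>R mat 1 + (s/2) *\<^sub>R (transpose A ** A)"

text \<open>The factor \<open>1 + \<parallel>A\<parallel>\<^sup>2\<close> bounds the eigenvalues of \<open>polar_form s A\<close>.\<close>

definition polar_contraction :: "real \<Rightarrow> real^'m^'m \<Rightarrow> real^'m^'m" where
  "polar_contraction s A = mat 1 - (1 / (1 + (norm A)\<^sup>2)) *\<^sub>R polar_form s A"

text \<open>The positive square root of \<open>polar_form s A\<close> divided by
  \<open>1 + (norm A)^2\<close>. Scaling makes the root equation solvable, and the scalar drops out
  of the conjugation.\<close>

definition polar_conjugator :: "real \<Rightarrow> real^'m^'m \<Rightarrow> real^'m^'m" where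
  "polar_conjugator s A = mat 1 - mat_root (polar_contraction s A)"

definition polar_homotopy :: "real \<Rightarrow> real^'m^'m \<Rightarrow> real^'m^'m" where
  "polar_homotopy s A = polar_conjugator s A ** A ** matrix_inv (polar_conjugator s A)"

text \<open>With \<open>l = 1 + (norm A)^2\<close> and \<open>h = polar_form s A *v x\<close>, the
  bound \<open>h \<bullet> h \<le> l * (h \<bullet> x)\<close> makes the squared norm of
  \<open>x - h / l\<close> at most \<open>x \<bullet> x - (h \<bullet> x) / l\<close>. Together with
  \<open>h \<bullet> x \<ge> (x \<bullet> x) / 2\<close> this gives the factor
  \<open>1 - 1 / (2 * l)\<close>. Replacing \<open>norm A\<close> by \<open>r\<close> makes the
  bound uniform on balls, as continuity requires.\<close>

lemma op_bounded_polar_contraction: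
  fixes A :: "real^'m^'m"
  assumes s: "s \<in> {0..1}" and A: "norm A \<le> r"
  shows "op_bounded (sqrt (1 - 1 / (2 * (1 + r\<^sup>2)))) (polar_contraction s A)"
  unfolding op_bounded_def
proof (intro conjI allI)
  show "transpose (polar_contraction s A) = polar_contraction s A"
    by (simp add: polar_contraction_def polar_form_def mat_simps)
  fix x :: "real^'m"
  define a b m where "a = 1 - s/2" and "b = s/2" and "m = (norm A)\<^sup>2"
  define l where "l = 1 + m"
  define h where "h = polar_form s A *v x"
  define y where "y = A *v x"
  define z where "z = transpose A *v y"
  have ab: "1/2 \<le> a" "a \<le> 1" "0 \<le> b" "b \<le> 1" and m: "0 \<le> m" and l: "1 \<le> l"
    using s by (auto simp: a_def b_def m_def l_def)
  have h: "h = a *\<^sub>R x + b *\<^sub>R z"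
    by (simp add: h_def y_def z_def a_def b_def polar_form_def matrix_vector_mult_add_rdistrib
        scaleR_matrix_vector_assoc[symmetric] matrix_vector_mul_assoc del: transpose_matrix_vector)
  have zx: "z \<bullet> x = y \<bullet> y" by (simp add: z_def y_def dot_lmul_matrix)
  have yx: "y \<bullet> y \<le> m * (x \<bullet> x)"
    using power_mono[OF norm_matrix_vector_mult_le[of A x] norm_ge_zero, of 2]
    by (simp add: y_def m_def power_mult_distrib power2_norm_eq_inner)
  have zy: "z \<bullet> z \<le> m * (y \<bullet> y)"
    using power_mono[OF norm_matrix_vector_mult_le[of "transpose A" y] norm_ge_zero, of 2]
    by (simp add: z_def m_def power_mult_distrib power2_norm_eq_inner norm_transpose)
  have hx: "h \<bullet> x = a * (x \<bullet> x) + b * (y \<bullet> y)" by (simp add: h inner_add_left zx)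
  have hx0: "0 \<le> h \<bullet> x" unfolding hx using ab by simp
  have "h \<bullet> h = a^2 * (x \<bullet> x) + 2 * (a * b) * (y \<bullet> y) + b^2 * (z \<bullet> z)"
    by (simp add: h inner_add_left inner_add_right inner_commute[of x z] zx power2_eq_square algebra_simps)
  \<comment> \<open>The added term is nonnegative by \<open>yx\<close> and is chosen so that the
    right-hand side factors as \<open>(a + b * m) * (h \<bullet> x)\<close>. This replaces an
    eigenvalue argument.\<close>
  also have "\<dots> \<le> a^2 * (x \<bullet> x) + 2 * (a * b) * (y \<bullet> y) + b^2 * (m * (y \<bullet> y)) + (a * b) * (m * (x \<bullet> x) - y \<bullet> y)"
  proof -
    have "0 \<le> (a * b) * (m * (x \<bullet> x) - y \<bullet> y)" using ab yx by (intro mult_nonneg_nonneg) auto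
    moreover have "b^2 * (z \<bullet> z) \<le> b^2 * (m * (y \<bullet> y))" by (intro mult_left_mono zy) simp
    ultimately show ?thesis by linarith
  qed
  also have "\<dots> = (a + b * m) * (h \<bullet> x)" by (simp add: hx power2_eq_square algebra_simps)
  also have "\<dots> \<le> l * (h \<bullet> x)"
    using hx0 ab m mult_right_mono[of b 1 m] by (intro mult_right_mono) (auto simp: l_def)
  finally have hh: "h \<bullet> h \<le> l * (h \<bullet> x)" .
  have "polar_contraction s A *v x = x - (1/l) *\<^sub>R h"
    by (simp add: polar_contraction_def h_def l_def m_def matrix_vector_mult_diff_rdistrib
        scaleR_matrix_vector_assoc[symmetric])
  then have "(norm (polar_contraction s A *v x))\<^sup>2 = (x - (1/l) *\<^sub>R h) \<bullet> (x - (1/l) *\<^sub>R h)"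
    by (simp only: power2_norm_eq_inner)
  also have "(x - k *\<^sub>R h) \<bullet> (x - k *\<^sub>R h) = x \<bullet> x - (2 * k) * (h \<bullet> x) + k * (k * (h \<bullet> h))" for k
    by (simp add: inner_diff_left inner_diff_right inner_commute[of x h] algebra_simps)
  also have "x \<bullet> x - (2 * (1/l)) * (h \<bullet> x) + (1/l) * ((1/l) * (h \<bullet> h))
      = x \<bullet> x - (2/l) * (h \<bullet> x) + (1/l) * ((1/l) * (h \<bullet> h))"
    by simp
  also have "(1/l) * (h \<bullet> h) \<le> h \<bullet> x" using hh l by (simp add: field_simps)
  then have "x \<bullet> x - (2/l) * (h \<bullet> x) + (1/l) * ((1/l) * (h \<bullet> h)) \<le> x \<bullet> x - (2/l) * (h \<bullet> x) + (1/l) * (h \<bullet> x)"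
    using l by (intro add_left_mono mult_left_mono) auto
  also have "\<dots> = x \<bullet> x - (1/l) * (h \<bullet> x)" by (simp add: algebra_simps)
  also have "\<dots> \<le> x \<bullet> x - (1/l) * ((1/2) * (x \<bullet> x))"
  proof -
    have "(1/2) * (x \<bullet> x) \<le> a * (x \<bullet> x)" using ab by (intro mult_right_mono) auto
    moreover have "0 \<le> b * (y \<bullet> y)" using ab by simp
    ultimately have "(1/2) * (x \<bullet> x) \<le> h \<bullet> x" unfolding hx by linarith
    then show ?thesis using l by (intro diff_left_mono mult_left_mono) auto
  qed
  also have "\<dots> = (1 - 1 / (2 * l)) * (x \<bullet> x)" by (simp add: algebra_simps)
  also have "\<dots> \<le> (1 - 1 / (2 * (1 + r\<^sup>2))) * (x \<bullet> x)"
  proof -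
    have "l \<le> 1 + r\<^sup>2" unfolding l_def m_def using A by (intro add_left_mono power_mono) auto
    then show ?thesis using l by (intro mult_right_mono diff_left_mono frac_le) auto
  qed
  finally have "(norm (polar_contraction s A *v x))\<^sup>2 \<le> (1 - 1 / (2 * (1 + r\<^sup>2))) * (norm x)\<^sup>2"
    by (simp add: power2_norm_eq_inner)
  then show "norm (polar_contraction s A *v x) \<le> sqrt (1 - 1 / (2 * (1 + r\<^sup>2))) * norm x"
    by (metis norm_ge_zero real_le_rsqrt real_sqrt_abs2 real_sqrt_mult abs_of_nonneg power2_eq_square)
qed

lemma contraction_bound:
  fixes r :: real
  shows "0 \<le> sqrt (1 - 1 / (2 * (1 + r\<^sup>2)))" "sqrt (1 - 1 / (2 * (1 + r\<^sup>2))) < 1"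
proof -
  have "0 < 1 + r\<^sup>2" "1 \<le> 2 * (1 + r\<^sup>2)" by (simp_all add: add_pos_nonneg)
  then show "0 \<le> sqrt (1 - 1 / (2 * (1 + r\<^sup>2)))" "sqrt (1 - 1 / (2 * (1 + r\<^sup>2))) < 1"
    by (simp_all add: divide_le_eq)
qed

lemma polar_conjugator_props:
  assumes s: "s \<in> {0..1}"
  shows "invertible (polar_conjugator s A)" "transpose (polar_conjugator s A) = polar_conjugator s A"
    "polar_conjugator s A ** polar_conjugator s A = (1 / (1 + (norm A)\<^sup>2)) *\<^sub>R polar_form s A"
proof -
  note * = mat_root_props[OF op_bounded_polar_contraction[OF s order_refl[of "norm A"]] contraction_bound]
  show "invertible (polar_conjugator s A)"
    unfolding polar_conjugator_def by (rule op_bounded_invertible[OF *(1) contraction_bound(2)])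
  show "transpose (polar_conjugator s A) = polar_conjugator s A"
    using *(1) by (simp add: polar_conjugator_def op_bounded_def transpose_linear)
  show "polar_conjugator s A ** polar_conjugator s A = (1 / (1 + (norm A)\<^sup>2)) *\<^sub>R polar_form s A"
    unfolding polar_conjugator_def root_eq_square[OF *(2)] by (simp add: polar_contraction_def)
qed

text \<open>Continuity of \<open>mat_root\<close> is available only for contractions with a fixed
  bound, and the bound approaches 1 as \<open>norm A\<close> grows. So continuity is first shown
  over each ball and then localised at every point.\<close>

lemma continuous_on_polar_homotopy:
  "continuous_on ({0..1} \<times> (UNIV :: (real^'m^'m) set)) (\<lambda>p. polar_homotopy (fst p) (snd p))"
proof -
  have C: "continuous_on S (\<lambda>p. polar_contraction (fst p) (snd p :: real^'m^'m))" for S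
    unfolding polar_contraction_def polar_form_def
    by (intro continuous_intros mmult.continuous_on
        continuous_on_compose2[OF linear_continuous_on[OF linear_conv_bounded_linear[THEN iffD1, OF linear_transpose], of UNIV]])
      (auto simp: add_nonneg_eq_0_iff)
  have loc: "continuous_on ({0..1} \<times> cball 0 r) (\<lambda>p. polar_conjugator (fst p) (snd p :: real^'m^'m))" for r
  proof -
    have "(\<lambda>p. polar_contraction (fst p) (snd p)) ` ({0..1} \<times> cball 0 r)
        \<subseteq> {C :: real^'m^'m. op_bounded (sqrt (1 - 1 / (2 * (1 + r\<^sup>2)))) C}"
    proof (rule image_subsetI)
      fix p :: "real \<times> (real^'m^'m)" assume "p \<in> {0..1} \<times> cball 0 r"
      then have "fst p \<in> {0..1}" "norm (snd p) \<le> r" by (auto simp: mem_Times_iff)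
      from op_bounded_polar_contraction[OF this]
      show "polar_contraction (fst p) (snd p) \<in> {C. op_bounded (sqrt (1 - 1 / (2 * (1 + r\<^sup>2)))) C}" ..
    qed
    then show ?thesis
      unfolding polar_conjugator_def
      by (intro continuous_on_diff continuous_on_const
          continuous_on_compose2[OF continuous_on_mat_root[OF contraction_bound] C])
  qed
  have "continuous_on ({0..1} \<times> UNIV) (\<lambda>p. polar_conjugator (fst p) (snd p :: real^'m^'m))"
    unfolding continuous_on_eq_continuous_within
  proof
    fix p :: "real \<times> (real^'m^'m)" assume p: "p \<in> {0..1} \<times> UNIV"
    define r where "r = norm (snd p) + 1"
    have "at p within ({0..1} \<times> UNIV) = at p within ({0..1} \<times> cball 0 r)"
      by (rule at_within_nhd[of _ "UNIV \<times> ball 0 r"]) (auto simp: r_def open_Times mem_Times_iff)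
    moreover have "p \<in> {0..1} \<times> cball 0 r" using p by (auto simp: r_def)
    note bspec[OF loc[of r, unfolded continuous_on_eq_continuous_within] this]
    ultimately show "continuous (at p within {0..1} \<times> UNIV) (\<lambda>p. polar_conjugator (fst p) (snd p))"
      by (simp only:)
  qed
  then show ?thesis
    unfolding polar_homotopy_def
    by (intro mmult.continuous_on continuous_intros continuous_on_compose2[OF continuous_on_matrix_inv])
      (auto simp: polar_conjugator_props)
qed

lemma polar_homotopy_in_twistor_space:
  assumes "s \<in> {0..1}" and A: "A \<in> twistor_space"
  shows "polar_homotopy s A \<in> twistor_space"
  using polar_conjugator_props(1)[OF assms(1), of A]
  by (simp add: twistor_space_iff polar_homotopy_def mat_simps matrix_inv_eqs twistor_cancel[OF A])

text \<open>The transpose of \<open>?Q A ?R\<close> is \<open>?R (A^t ?Q ?Q) ?R\<close>. As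
  \<open>?Q ?Q\<close> is a multiple of the invariant form, \<open>A\<close> is skew for it (fact
  \<open>H\<close>), and this becomes \<open>- ?Q A ?R\<close>.\<close>

lemma polar_homotopy_1:
  fixes A :: "real^'m^'m"
  assumes A: "A \<in> twistor_space"
  shows "polar_homotopy 1 A \<in> orthogonal_twistor_space"
proof -
  let ?Q = "polar_conjugator 1 A"
  let ?R = "matrix_inv ?Q"
  have Q: "invertible ?Q" "transpose ?Q = ?Q" "?Q ** ?Q = (1 / (1 + (norm A)\<^sup>2)) *\<^sub>R polar_form 1 A"
    by (simp_all add: polar_conjugator_props)
  have R: "transpose ?R = ?R"
    using matrix_inv_unique(1)[of ?Q "transpose ?R"] arg_cong[OF matrix_inv_eqs(2)[OF Q(1)], of transpose]
    by (simp add: matrix_transpose_mul Q(2))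
  have H: "transpose A ** (?Q ** ?Q) = - (?Q ** ?Q ** A)"
  proof -
    have "transpose A ** transpose A = - mat 1"
      using arg_cong[OF twistor_cancel(1)[OF A], of transpose]
      by (simp add: matrix_transpose_mul transpose_linear)
    then have "transpose A ** (transpose A ** X) = - X" for X :: "real^'m^'m"
      by (simp add: matrix_mul_assoc mmult.minus_left)
    \<comment> \<open>Both sides equal \<open>(A^t - A) / 2\<close>.\<close>
    then have "transpose A ** polar_form 1 A = - (polar_form 1 A ** A)"
      by (simp add: polar_form_def mat_simps twistor_cancel[OF A])
    then show ?thesis unfolding Q(3) by (simp add: mmult.scaleR_left mmult.scaleR_right)
  qed
  have "transpose (polar_homotopy 1 A) = ?R ** (transpose A ** (?Q ** ?Q)) ** ?R"
    by (simp add: polar_homotopy_def matrix_transpose_mul R Q(2) matrix_mul_assoc[symmetric] matrix_inv_eqs Q(1))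
  also have "\<dots> = - polar_homotopy 1 A"
    unfolding H by (simp add: polar_homotopy_def mmult.minus_left mmult.minus_right
        matrix_mul_assoc[symmetric] matrix_inv_eqs Q(1))
  finally show ?thesis
    using polar_homotopy_in_twistor_space[OF _ A, of 1] by (simp add: orthogonal_twistor_space_def)
qed

text \<open>For a scalar form the scalar root \<open>1 - q\<close> solves the root equation, so by
  uniqueness the conjugator is \<open>q\<close> times the identity. This covers \<open>s = 0\<close>
  as well as orthogonal \<open>A\<close>.\<close>

lemma polar_homotopy_fix:
  fixes A :: "real^'m^'m"
  assumes "polar_form s A = mat 1"
  shows "polar_homotopy s A = A"
proof -
  define q where "q = sqrt (1 / (1 + (norm A)\<^sup>2))"
  have l: "1 \<le> 1 + (norm A)\<^sup>2" by simp
  have q: "0 < q" "q \<le> 1" "q\<^sup>2 = 1 / (1 + (norm A)\<^sup>2)"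
    using l by (simp_all add: q_def add_pos_nonneg del: real_sqrt_divide)
  let ?Y = "(1 - q) *\<^sub>R (mat 1 :: real^'m^'m)"
  have C: "polar_contraction s A = (1 - q\<^sup>2) *\<^sub>R mat 1"
    by (simp add: polar_contraction_def assms q scaleR_diff_left)
  have "op_bounded (1 - q) ?Y"
    using q by (simp add: op_bounded_def transpose_scalar scaleR_matrix_vector_assoc[symmetric])
  moreover have "root_eq (polar_contraction s A) ?Y"
  proof -
    have "1 - q = 1/2 * ((1 - q\<^sup>2) + (1 - q) * (1 - q))" by (simp add: power2_eq_square algebra_simps)
    moreover have "?Y ** ?Y = ((1 - q) * (1 - q)) *\<^sub>R mat 1" by (simp add: mmult.scaleR_left mmult.scaleR_right)
    ultimately show ?thesis unfolding root_eq_def C by (metis scaleR_add_left scaleR_scaleR)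
  qed
  ultimately have "mat_root (polar_contraction s A) = ?Y"
    using q by (intro mat_root_eqI[of "1 - q"]) auto
  then have Q: "polar_conjugator s A = q *\<^sub>R mat 1"
    by (simp add: polar_conjugator_def scaleR_diff_left)
  have "matrix_inv (mat 1 :: real^'m^'m) = mat 1" "invertible (mat 1 :: real^'m^'m)"
    using matrix_inv_unique[of "mat 1 :: real^'m^'m" "mat 1"] by auto
  then show ?thesis
    using q(1) by (simp add: polar_homotopy_def Q matrix_inv_scaleR mat_simps)
qed

lemma polar_homotopy_0: "polar_homotopy 0 A = A"
  by (rule polar_homotopy_fix) (simp add: polar_form_def)

lemma polar_homotopy_orthogonal: "A \<in> orthogonal_twistor_space \<Longrightarrow> polar_homotopy s A = A"
  by (rule polar_homotopy_fix)
    (auto simp: polar_form_def orthogonal_twistor_space_def mat_simps twistor_cancel scaleR_add_left[symmetric])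

lemma twistor_deformation_retract:
  "deformation_retract_of (orthogonal_twistor_space :: (real^'m^'m) set) twistor_space"
  unfolding deformation_retract_of_def
proof (intro exI[of _ "polar_homotopy 1"] conjI)
  let ?h = "\<lambda>p :: real \<times> (real^'m^'m). polar_homotopy (fst p) (snd p)"
  have c: "continuous_on ({0..1} \<times> twistor_space) ?h"
    by (rule continuous_on_subset[OF continuous_on_polar_homotopy]) auto
  have "continuous_on twistor_space (\<lambda>A. ?h (1, A))"
    by (rule continuous_on_compose2[OF c]) (auto intro!: continuous_intros)
  then have "continuous_on twistor_space (polar_homotopy 1 :: real^'m^'m \<Rightarrow> _)" by simp
  then show "retraction twistor_space orthogonal_twistor_space (polar_homotopy 1 :: real^'m^'m \<Rightarrow> _)"
    using polar_homotopy_1 polar_homotopy_orthogonal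
    by (auto simp: retraction_def orthogonal_twistor_space_def)
  show "homotopic_with_canon (\<lambda>h. \<forall>x\<in>orthogonal_twistor_space. h x = x) twistor_space twistor_space
      id (polar_homotopy 1 :: real^'m^'m \<Rightarrow> _)"
    unfolding homotopic_with_def
    using c by (intro exI[of _ ?h])
      (auto simp: prod_topology_subtopology_eu polar_homotopy_in_twistor_space polar_homotopy_0
        polar_homotopy_orthogonal)
qed

text \<open>The retraction is a conjugation, so \<open>A\<close> is similar to a skew matrix. The
  vanishing trace makes the dimension formulas independent of \<open>A\<close>.\<close>

lemma trace_twistor:
  assumes A: "A \<in> twistor_space"
  shows "trace A = 0"
proof -
  let ?B = "polar_homotopy 1 A"
  have "trace ?B = trace A"
    unfolding polar_homotopy_def
    by (subst trace_mul_sym) (simp add: matrix_mul_assoc[symmetric] matrix_inv_eqs polar_conjugator_props)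
  moreover have "trace ?B = - trace ?B"
  proof -
    have "trace ?B = trace (transpose ?B)" by (simp add: trace_def transpose_def)
    also have "transpose ?B = - ?B" using polar_homotopy_1[OF A] by (simp add: orthogonal_twistor_space_def)
    finally show ?thesis by (simp add: trace_def sum_negf)
  qed
  ultimately show ?thesis by simp
qed

section \<open>Dimensions and the fundamental form\<close>

text \<open>Expanding \<open>P b\<close> in an orthonormal basis \<open>C\<close> of
  \<open>L\<close> turns the trace into the sum of \<open>P c \<bullet> c\<close> over
  \<open>C\<close>, and \<open>P\<close> fixes each \<open>c\<close>. The projection may be
  oblique.\<close>

lemma dim_eq_trace_projection:
  fixes P :: "'a::euclidean_space \<Rightarrow> 'a"
  assumes P: "linear P" and L: "subspace L" and range: "\<And>x. P x \<in> L" and fixed: "\<And>x. x \<in> L \<Longrightarrow> P x = x"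
  shows "real (dim L) = (\<Sum>b\<in>Basis. P b \<bullet> b)"
proof -
  obtain C where C: "C \<subseteq> L" "pairwise orthogonal C" "\<And>x. x \<in> C \<Longrightarrow> norm x = 1"
    "independent C" "card C = dim L" "span C = L"
    using orthonormal_basis_subspace[OF L] by metis
  have fin: "finite C" using C(4) by (rule independent_imp_finite)
  have expand: "y = (\<Sum>c\<in>C. (y \<bullet> c) *\<^sub>R c)" if "y \<in> L" for y
    using orthonormal_basis_expand[OF C(2) C(3) _ fin] that C(6) by simp
  have "(\<Sum>b\<in>Basis. P b \<bullet> b) = (\<Sum>b\<in>Basis. \<Sum>c\<in>C. (P b \<bullet> c) * (c \<bullet> b))"
    by (rule sum.cong[OF refl], subst expand[OF range]) (simp add: inner_sum_left)
  also have "\<dots> = (\<Sum>c\<in>C. \<Sum>b\<in>Basis. (P b \<bullet> c) * (c \<bullet> b))" by (rule sum.swap)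
  also have "\<dots> = (\<Sum>c\<in>C. P (\<Sum>b\<in>Basis. (c \<bullet> b) *\<^sub>R b) \<bullet> c)"
    by (simp add: linear_sum[OF P] linear_cmul[OF P] inner_sum_left mult.commute)
  also have "\<dots> = (\<Sum>c\<in>C. 1)"
    using C(1,3) fixed by (intro sum.cong) (auto simp: euclidean_representation norm_eq_1)
  finally show ?thesis by (simp add: C(5))
qed

lemma sum_Basis_matrix:
  fixes P :: "real^'m^'m \<Rightarrow> real^'m^'m"
  shows "(\<Sum>b\<in>Basis. P b \<bullet> b) = (\<Sum>i\<in>UNIV. \<Sum>j\<in>UNIV. P (axis i (axis j 1)) $ i $ j)"
proof -
  have B: "(Basis :: (real^'m) set) = (\<lambda>j. axis j 1) ` UNIV"
    "(Basis :: (real^'m^'m) set) = (\<lambda>(i, j). axis i (axis j 1)) ` UNIV"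
    by (auto simp: Basis_vec_def image_iff)
  have "inj (\<lambda>(i, j). axis i (axis j 1) :: real^'m^'m)"
    by (auto simp: inj_def axis_eq_axis)
  then have "(\<Sum>b\<in>Basis. P b \<bullet> b) = (\<Sum>(i, j)\<in>UNIV. P (axis i (axis j 1)) $ i $ j)"
    unfolding B by (subst sum.reindex) (auto simp: inner_axis case_prod_unfold)
  then show ?thesis by (simp add: sum.cartesian_product)
qed

lemma matrix_unit_component: "(axis i (axis j 1) :: real^'m^'m) $ k $ l = (if i = k \<and> j = l then 1 else 0)"
  by (simp add: axis_def)

text \<open>At \<open>k = i\<close>, \<open>l = j\<close> this is the diagonal coefficient of the
  map sending \<open>X\<close> to \<open>A X B\<close>, whose trace is thus
  \<open>trace A * trace B\<close>.\<close>

lemma matrix_unit_conj: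
  fixes A B :: "real^'m^'m"
  shows "(A ** axis i (axis j 1) ** B) $ k $ l = A $ k $ i * B $ j $ l"
proof -
  have "(A ** axis i (axis j 1)) $ k $ p = (if j = p then A $ k $ i else 0)" for p
    by (simp add: matrix_matrix_mult_def matrix_unit_component if_distrib[of "(*) _"] cong: if_cong)
  then show ?thesis
    by (simp add: matrix_matrix_mult_def[of "A ** _"] if_distrib[of "\<lambda>x. x * _"] cong: if_cong)
qed

lemma transpose_matrix_unit: "transpose (axis i (axis j 1)) = (axis j (axis i 1) :: real^'m^'m)"
  by (auto simp: transpose_def vec_eq_iff matrix_unit_component)

text \<open>The trace computations show that the dimension of the tangent space is the same at every point.\<close>

lemma dim_anticommutant:
  fixes A :: "real^'m^'m"
  assumes A: "A \<in> twistor_space"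
  shows "2 * real (dim (anticommutant A)) = (real CARD('m))\<^sup>2"
proof -
  \<comment> \<open>\<open>X\<close> anticommutes with \<open>A\<close> exactly when
    \<open>A X A = X\<close>; the projection averages over this involution.\<close>
  let ?P = "\<lambda>X. (1/2) *\<^sub>R (X + A ** X ** A)"
  have "real (dim (anticommutant A)) = (\<Sum>b\<in>Basis. ?P b \<bullet> b)"
  proof (rule dim_eq_trace_projection[OF _ subspace_anticommutant])
    show "linear ?P" by (rule linearI) (simp_all add: mat_simps algebra_simps)
    show "?P X \<in> anticommutant A" for X
      by (simp add: anticommutant_def mat_simps twistor_cancel[OF A] scaleR_diff_right)
    show "?P X = X" if "X \<in> anticommutant A" for X
      by (simp add: mat_simps anticommute_cancel[OF that] twistor_cancel[OF A] scaleR_add_left[symmetric])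
  qed
  also have "\<dots> = (\<Sum>i\<in>UNIV. \<Sum>j\<in>UNIV. (1/2) * (1 + A $ i $ i * A $ j $ j))"
    unfolding sum_Basis_matrix by (simp add: matrix_unit_conj)
  also have "\<dots> = (1/2) * ((real CARD('m))\<^sup>2 + trace A * trace A)"
    by (simp add: sum.distrib sum_divide_distrib[symmetric] trace_def sum_product power2_eq_square add_divide_distrib)
  finally show ?thesis by (simp add: trace_twistor[OF A])
qed

text \<open>Here the average is over the group generated by the commuting involutions
  \<open>A X A\<close> and \<open>- X^t\<close>. Its trace depends on \<open>A\<close> only through
  \<open>trace A = 0\<close> and \<open>A \<bullet> A\<close>, which is the size of the
  matrix.\<close>

lemma dim_skew_anticommutant:
  fixes A :: "real^'m^'m"
  assumes A: "A \<in> orthogonal_twistor_space"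
  shows "4 * real (dim (skew_anticommutant A)) = (real CARD('m))\<^sup>2 - 2 * real CARD('m)"
proof -
  have A': "A \<in> twistor_space" "transpose A = - A" using A by (auto simp: orthogonal_twistor_space_def)
  let ?P = "\<lambda>X. (1/4) *\<^sub>R (X - transpose X + A ** X ** A - A ** transpose X ** A)"
  have "real (dim (skew_anticommutant A)) = (\<Sum>b\<in>Basis. ?P b \<bullet> b)"
  proof (rule dim_eq_trace_projection[OF _ subspace_skew_anticommutant])
    show "linear ?P" by (rule linearI) (simp_all add: mat_simps algebra_simps)
    show "?P X \<in> skew_anticommutant A" for X
      by (simp add: skew_anticommutant_def anticommutant_def mat_simps A' twistor_cancel[OF A'(1)] algebra_simps)
    show "?P X = X" if "X \<in> skew_anticommutant A" for X
    proof -
      have X: "X \<in> anticommutant A" "transpose X = - X" using that by (auto simp: skew_anticommutant_def)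
      show ?thesis
        by (simp add: mat_simps X(2) anticommute_cancel[OF X(1)] twistor_cancel[OF A'(1)] scaleR_add_left[symmetric])
    qed
  qed
  also have "\<dots> = (\<Sum>i\<in>UNIV. \<Sum>j\<in>UNIV. (1/4) * (1 - (if i = j then 1 else 0) + A $ i $ i * A $ j $ j - A $ i $ j * A $ i $ j))"
    unfolding sum_Basis_matrix
    by (intro sum.cong refl) (auto simp: matrix_unit_conj transpose_matrix_unit matrix_unit_component)
  also have "\<dots> = (1/4) * (real CARD('m) * real CARD('m) - real CARD('m) + trace A * trace A - A \<bullet> A)"
    by (simp only: sum_distrib_left[symmetric] sum.distrib sum_subtractf)
      (simp add: trace_def inner_vec_def sum_distrib_left[symmetric] sum_distrib_right[symmetric])
  also have "A \<bullet> A = real CARD('m)"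
    by (simp add: trace_form_eq_inner[symmetric] trace_form_def A' mmult.minus_right twistor_cancel[OF A'(1)] trace_I)
  finally show ?thesis by (simp add: trace_twistor[OF A'(1)] power2_eq_square)
qed

lemma submanifold_twistor_space: "submanifold (twistor_space :: (real^'m^'m) set)"
proof -
  have "dim (anticommutant A) = dim (anticommutant B)" if "A \<in> twistor_space" "B \<in> twistor_space"
    for A B :: "real^'m^'m"
    using that[THEN dim_anticommutant] by linarith
  then show ?thesis
    unfolding submanifold_def using twistor.submanifold_dim by (metis (no_types, lifting))
qed

lemma submanifold_orthogonal_twistor_space: "submanifold (orthogonal_twistor_space :: (real^'m^'m) set)"
proof -
  have "dim (skew_anticommutant A) = dim (skew_anticommutant B)"
    if "A \<in> orthogonal_twistor_space" "B \<in> orthogonal_twistor_space" for A B :: "real^'m^'m"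
    using that[THEN dim_skew_anticommutant] by linarith
  then show ?thesis
    unfolding submanifold_def using orthogonal_twistor.submanifold_dim by (metis (no_types, lifting))
qed

section \<open>Symmetry of second derivatives\<close>

lemma second_difference_mvt:
  fixes f :: "'a::real_normed_vector \<Rightarrow> real"
  assumes f: "\<And>x. x \<in> U \<Longrightarrow> (f has_derivative f' x) (at x)"
    and f2: "\<And>x. x \<in> U \<Longrightarrow> ((\<lambda>x. f' x u) has_derivative f2 x) (at x)"
    and s: "0 < s"
    and U: "\<And>a b. 0 \<le> a \<Longrightarrow> a \<le> s \<Longrightarrow> 0 \<le> b \<Longrightarrow> b \<le> s \<Longrightarrow> q + a *\<^sub>R u + b *\<^sub>R v \<in> U"
  obtains a b where "0 \<le> a" "a \<le> s" "0 \<le> b" "b \<le> s"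
    "f (q + s *\<^sub>R u + s *\<^sub>R v) - f (q + s *\<^sub>R u) - f (q + s *\<^sub>R v) + f q
      = s * (s * f2 (q + a *\<^sub>R u + b *\<^sub>R v) v)"
proof -
  have line: "((\<lambda>t. g (p + t *\<^sub>R w)) has_real_derivative g' w) (at t)"
    if "(g has_derivative g') (at (p + t *\<^sub>R w))" for g :: "'a \<Rightarrow> real" and g' p w t
  proof -
    have "((\<lambda>t. p + t *\<^sub>R w) has_derivative (\<lambda>r. r *\<^sub>R w)) (at t)"
      by (auto intro!: derivative_eq_intros)
    from has_derivative_compose[OF this that] show ?thesis
      unfolding has_field_derivative_def
      by (simp add: linear_cmul[OF has_derivative_linear[OF that]] mult.commute[of _ "g' w"])
  qed
  let ?k = "\<lambda>t. f ((q + s *\<^sub>R v) + t *\<^sub>R u) - f (q + t *\<^sub>R u)"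
  have "\<exists>a. 0 < a \<and> a < s \<and> ?k s - ?k 0 = (s - 0) * (f' ((q + s *\<^sub>R v) + a *\<^sub>R u) u - f' (q + a *\<^sub>R u) u)"
  proof (rule MVT2[OF s])
    fix t assume t: "0 \<le> t" "t \<le> s"
    show "(?k has_real_derivative f' ((q + s *\<^sub>R v) + t *\<^sub>R u) u - f' (q + t *\<^sub>R u) u) (at t)"
      using U[of t s] U[of t 0] t s by (intro DERIV_diff line f) (auto simp: algebra_simps)
  qed
  then obtain a where a: "0 < a" "a < s"
    "?k s - ?k 0 = s * (f' ((q + s *\<^sub>R v) + a *\<^sub>R u) u - f' (q + a *\<^sub>R u) u)" by auto
  let ?l = "\<lambda>t. f' ((q + a *\<^sub>R u) + t *\<^sub>R v) u"
  have "\<exists>b. 0 < b \<and> b < s \<and> ?l s - ?l 0 = (s - 0) * f2 ((q + a *\<^sub>R u) + b *\<^sub>R v) v"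
  proof (rule MVT2[OF s])
    fix t assume t: "0 \<le> t" "t \<le> s"
    show "(?l has_real_derivative f2 ((q + a *\<^sub>R u) + t *\<^sub>R v) v) (at t)"
      by (rule line[where g = "\<lambda>x. f' x u", OF f2]) (use U[of a t] t a in auto)
  qed
  then obtain b where b: "0 < b" "b < s" "?l s - ?l 0 = s * f2 ((q + a *\<^sub>R u) + b *\<^sub>R v) v" by auto
  have "?k s - ?k 0 = s * (?l s - ?l 0)" using a(3) by (simp add: algebra_simps)
  also have "\<dots> = s * (s * f2 (q + a *\<^sub>R u + b *\<^sub>R v) v)" by (simp only: b(3))
  finally show ?thesis using a b by (intro that[of a b]) (simp_all add: algebra_simps)
qed

text \<open>The second difference over a small parallelogram is symmetric in \<open>u\<close> and
  \<open>v\<close>. The mean value theorem equates it with either mixed derivative at nearby points,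
  so by continuity the two cannot differ at \<open>q\<close>.\<close>

lemma symmetric_second_derivative_real:
  fixes f :: "'a::real_normed_vector \<Rightarrow> real"
  assumes U: "open U" "q \<in> U"
    and f: "\<And>x. x \<in> U \<Longrightarrow> (f has_derivative f' x) (at x)"
    and f2: "\<And>x u. x \<in> U \<Longrightarrow> ((\<lambda>x. f' x u) has_derivative f2 u x) (at x)"
    and cont: "\<And>u v. continuous_on U (\<lambda>x. f2 u x v)"
  shows "f2 u q v = f2 v q u"
proof (rule ccontr)
  assume "f2 u q v \<noteq> f2 v q u"
  then have e: "0 < \<bar>f2 u q v - f2 v q u\<bar> / 2" (is "0 < ?e") by simp
  have "isCont (\<lambda>x. f2 u x v) q" "isCont (\<lambda>x. f2 v x u) q"
    using cont U by (auto simp: continuous_on_eq_continuous_at)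
  then obtain d1 d2 where d: "d1 > 0" "\<And>x. dist x q < d1 \<Longrightarrow> \<bar>f2 u x v - f2 u q v\<bar> < ?e"
    "d2 > 0" "\<And>x. dist x q < d2 \<Longrightarrow> \<bar>f2 v x u - f2 v q u\<bar> < ?e"
    using e unfolding continuous_at_eps_delta dist_real_def by metis
  obtain d3 where d3: "d3 > 0" "ball q d3 \<subseteq> U" using U openE by blast
  define d where "d = min d1 (min d2 d3)"
  \<comment> \<open>This size keeps the whole parallelogram within distance \<open>d\<close> of
    \<open>q\<close>; the summand 1 avoids division by zero when \<open>u = v = 0\<close>.\<close>
  define s where "s = (d / 2) / (norm u + norm v + 1)"
  have n: "0 < norm u + norm v + 1" by (simp add: add_nonneg_pos)
  have d0: "0 < d" using d d3 by (simp add: d_def)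
  then have s: "0 < s" using n by (simp add: s_def)
  have near: "dist (q + a *\<^sub>R u + b *\<^sub>R v) q < d" if "0 \<le> a" "a \<le> s" "0 \<le> b" "b \<le> s" for a b
  proof -
    have "dist (q + a *\<^sub>R u + b *\<^sub>R v) q = norm (a *\<^sub>R u + b *\<^sub>R v)" by (simp add: dist_norm algebra_simps)
    also have "\<dots> \<le> a * norm u + b * norm v" using norm_triangle_ineq[of "a *\<^sub>R u" "b *\<^sub>R v"] that by simp
    also have "\<dots> \<le> s * norm u + s * norm v" using that by (intro add_mono mult_right_mono) auto
    also have "\<dots> \<le> s * (norm u + norm v + 1)" using s by (simp add: algebra_simps)
    also have "\<dots> = d / 2" unfolding s_def using n nonzero_divide_eq_eq less_irrefl by metis
    also have "\<dots> < d" using d0 by simp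
    finally show ?thesis .
  qed
  then have inU: "q + a *\<^sub>R u + b *\<^sub>R v \<in> U" if "0 \<le> a" "a \<le> s" "0 \<le> b" "b \<le> s" for a b
    using that d3(2) by (fastforce simp: d_def dist_commute subset_iff)
  obtain a b where 1: "0 \<le> a" "a \<le> s" "0 \<le> b" "b \<le> s"
    "f (q + s *\<^sub>R u + s *\<^sub>R v) - f (q + s *\<^sub>R u) - f (q + s *\<^sub>R v) + f q
      = s * (s * f2 u (q + a *\<^sub>R u + b *\<^sub>R v) v)"
    by (rule second_difference_mvt[OF f f2 s inU])
  have inU': "q + a *\<^sub>R v + b *\<^sub>R u \<in> U" if "0 \<le> a" "a \<le> s" "0 \<le> b" "b \<le> s" for a b
    using inU[of b a] that by (simp add: add.commute add.left_commute)
  obtain a' b' where 2: "0 \<le> a'" "a' \<le> s" "0 \<le> b'" "b' \<le> s"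
    "f (q + s *\<^sub>R v + s *\<^sub>R u) - f (q + s *\<^sub>R v) - f (q + s *\<^sub>R u) + f q
      = s * (s * f2 v (q + a' *\<^sub>R v + b' *\<^sub>R u) u)"
    by (rule second_difference_mvt[OF f f2 s inU'])
  have "q + s *\<^sub>R v + s *\<^sub>R u = q + s *\<^sub>R u + s *\<^sub>R v" by (simp add: add.commute add.left_commute)
  from 1(5) 2(5)[unfolded this] have "s * (s * f2 u (q + a *\<^sub>R u + b *\<^sub>R v) v) = s * (s * f2 v (q + a' *\<^sub>R v + b' *\<^sub>R u) u)"
    by linarith
  then have eq: "f2 u (q + a *\<^sub>R u + b *\<^sub>R v) v = f2 v (q + a' *\<^sub>R v + b' *\<^sub>R u) u" using s by simp
  have "\<bar>f2 u (q + a *\<^sub>R u + b *\<^sub>R v) v - f2 u q v\<bar> < ?e"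
    using near[OF 1(1-4)] by (intro d) (simp add: d_def)
  moreover have "\<bar>f2 v (q + a' *\<^sub>R v + b' *\<^sub>R u) u - f2 v q u\<bar> < ?e"
    using near[OF 2(3,4,1,2)] by (intro d) (simp add: d_def add.commute add.left_commute)
  ultimately show False unfolding eq by (simp add: abs_if field_simps split: if_splits)
qed

lemma symmetric_second_derivative:
  fixes f :: "'a::euclidean_space \<Rightarrow> 'b::euclidean_space"
  assumes U: "open U" "q \<in> U"
    and f: "\<And>x. x \<in> U \<Longrightarrow> (f has_derivative f' x) (at x)"
    and f2: "\<And>x u. x \<in> U \<Longrightarrow> ((\<lambda>x. f' x u) has_derivative f2 u x) (at x)"
    and cont: "\<And>u v. continuous_on U (\<lambda>x. f2 u x v)"
  shows "f2 u q v = f2 v q u"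
proof (rule euclidean_eqI)
  fix b :: 'b
  show "f2 u q v \<bullet> b = f2 v q u \<bullet> b"
    by (rule symmetric_second_derivative_real[OF U, of "\<lambda>x. f x \<bullet> b" "\<lambda>x u. f' x u \<bullet> b" "\<lambda>u x v. f2 u x v \<bullet> b"])
      (auto intro!: has_derivative_inner_left f f2 continuous_intros cont)
qed

text \<open>A parametrization agrees with its smooth ambient extension only on \<open>L\<close> near
  \<open>q\<close>, which suffices for derivatives in directions of \<open>L\<close>.\<close>

lemma dir_deriv_cong:
  assumes L: "subspace L" and W: "open W" and q: "q \<in> L \<inter> W" and u: "u \<in> L"
    and eq: "\<And>x. x \<in> L \<inter> W \<Longrightarrow> f x = g x"
  shows "dir_deriv f q u = dir_deriv g q u"
proof -
  have "open ((\<lambda>t::real. q + t *\<^sub>R u) -` W)" by (intro open_vimage W continuous_intros)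
  moreover have "0 \<in> (\<lambda>t::real. q + t *\<^sub>R u) -` W" using q by simp
  ultimately have "\<forall>\<^sub>F t in nhds (0::real). q + t *\<^sub>R u \<in> W" unfolding eventually_nhds by blast
  then have "\<forall>\<^sub>F t in nhds (0::real). f (q + t *\<^sub>R u) = g (q + t *\<^sub>R u)"
    by (rule eventually_mono) (use q u L in \<open>auto intro!: eq subspace_add subspace_scale\<close>)
  then show ?thesis
    unfolding dir_deriv_def by (intro vector_derivative_cong_eq) auto
qed

section \<open>Closedness of the fundamental form\<close>

lemma inner_matrix_left: "(A ** X) \<bullet> Y = X \<bullet> (transpose A ** Y)"
  for A X Y :: "real^'m^'m"
proof -
  have "trace (A ** (X ** transpose Y)) = trace ((X ** transpose Y) ** A)" by (rule trace_mul_sym)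
  then show ?thesis
    by (simp add: trace_form_eq_inner[symmetric] trace_form_def matrix_transpose_mul matrix_mul_assoc)
qed

lemma inner_matrix_right: "(X ** A) \<bullet> Y = X \<bullet> (Y ** transpose A)"
  for A X Y :: "real^'m^'m"
  by (simp add: trace_form_eq_inner[symmetric] trace_form_def matrix_transpose_mul matrix_mul_assoc)

text \<open>The second half of the metric contributes \<open>- (X \<bullet> (A ** Y)) / 2\<close>,
  which equals the first half because \<open>A\<close> is skew.\<close>

lemma fundamental_form_orthogonal:
  assumes "A \<in> orthogonal_twistor_space"
  shows "fundamental_form twistor_metric twistor_J A X Y = (A ** X) \<bullet> Y"
  using assms
  by (auto simp: fundamental_form_def twistor_metric_eq twistor_J_def orthogonal_twistor_space_def
      twistor_cancel inner_matrix_left mmult.minus_left)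

text \<open>Multiplication by the orthogonal matrix \<open>A\<close> preserves the inner product.
  \<open>X ** Y\<close> commutes with \<open>A\<close> while \<open>Z\<close> anticommutes, so the
  value equals its own negative.\<close>

lemma cubic_form_anticommutant:
  assumes A: "A \<in> orthogonal_twistor_space"
    and X: "X \<in> anticommutant A" and Y: "Y \<in> anticommutant A" and Z: "Z \<in> anticommutant A"
  shows "(X ** Y) \<bullet> Z = 0"
proof -
  have A': "A \<in> twistor_space" "transpose A = - A" using A by (auto simp: orthogonal_twistor_space_def)
  have "(X ** Y) \<bullet> Z = (A ** (X ** Y)) \<bullet> (A ** Z)"
    by (simp add: inner_matrix_left A' mmult.minus_left twistor_cancel[OF A'(1)])
  also have "A ** (X ** Y) = (X ** Y) ** A"
    by (simp add: mat_simps anticommute_cancel[OF X] anticommute_cancel[OF Y])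
  also have "A ** Z = - (Z ** A)" by (rule anticommute_cancel[OF Z])
  also have "((X ** Y) ** A) \<bullet> - (Z ** A) = (X ** Y) \<bullet> (- (Z ** A) ** transpose A)"
    by (rule inner_matrix_right)
  also have "- (Z ** A) ** transpose A = - Z" by (simp add: A' mat_simps twistor_cancel[OF A'(1)])
  finally show ?thesis by simp
qed

lemma closed_fundamental_form:
  "closed_2form orthogonal_twistor_space (fundamental_form twistor_metric twistor_J)"
  unfolding closed_2form_def
proof (intro allI impI ballI)
  fix L V :: "(real^'m^'m) set" and \<psi> q u v w
  let ?w = "fundamental_form twistor_metric twistor_J :: real^'m^'m \<Rightarrow> _"
  assume "local_parametrization orthogonal_twistor_space L V \<psi>"
    and qV: "q \<in> V" and uvw: "u \<in> L" "v \<in> L" "w \<in> L"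
  then have L: "subspace L" and V: "openin (top_of_set L) V" and sm: "smooth_map_on V \<psi>"
    and im: "\<psi> ` V \<subseteq> orthogonal_twistor_space"
    by (auto simp: local_parametrization_def dest: openin_imp_subset)
  obtain V' where V': "open V'" "V = L \<inter> V'" using V openin_open by metis
  obtain U F where U: "open U" "q \<in> U" "\<forall>k. Ck_on k F U" "\<forall>y\<in>V \<inter> U. F y = \<psi> y"
    using sm qV unfolding smooth_map_on_def by blast
  from U(3) have "Ck_on (Suc (Suc 0)) F U" ..
  then obtain F' where F': "\<And>x. x \<in> U \<Longrightarrow> (F has_derivative F' x) (at x)"
    "\<And>v. Ck_on (Suc 0) (\<lambda>x. F' x v) U"
    unfolding Ck_on.simps(2)[of "Suc 0"] by blast
  then have "\<forall>v. \<exists>G. (\<forall>x\<in>U. ((\<lambda>x. F' x v) has_derivative G x) (at x)) \<and> (\<forall>w. continuous_on U (\<lambda>x. G x w))"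
    by simp
  then obtain F2 where F2: "\<And>x v. x \<in> U \<Longrightarrow> ((\<lambda>x. F' x v) has_derivative F2 v x) (at x)"
    "\<And>v w. continuous_on U (\<lambda>x. F2 v x w)"
    by metis
  define W where "W = U \<inter> V'"
  have W: "open W" "q \<in> L \<inter> W" and WU: "\<And>x. x \<in> L \<inter> W \<Longrightarrow> x \<in> U \<inter> V"
    using U V' qV by (auto simp: W_def)
  have F: "F x = \<psi> x" "F x \<in> orthogonal_twistor_space" if "x \<in> L \<inter> W" for x
    using WU[OF that] U(4) im by auto
  have d\<psi>: "dir_deriv \<psi> x v = F' x v" if "x \<in> L \<inter> W" "v \<in> L" for x v
    using dir_deriv_cong[OF L W(1) that, of \<psi> F] F(1) dir_deriv_eq[OF F'(1)] WU that by auto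
  \<comment> \<open>Off \<open>L\<close> the extension \<open>F\<close> may leave the twistor space,
    so \<open>F^2 = -1\<close> is differentiated only in directions of \<open>L\<close>.\<close>
  have anti: "F' q x \<in> anticommutant (F q)" if "x \<in> L" for x
  proof -
    have "dir_deriv (\<lambda>y. F y ** F y) q x = F q ** F' q x + F' q x ** F q"
      by (rule dir_deriv_eq) (rule mmult.FDERIV[OF F'(1)[OF U(2)] F'(1)[OF U(2)]])
    moreover have "dir_deriv (\<lambda>y. F y ** F y) q x = dir_deriv (\<lambda>y. - mat 1) q x"
      using F(2) by (intro dir_deriv_cong[OF L W that]) (auto simp: orthogonal_twistor_space_def twistor_cancel)
    moreover have "dir_deriv (\<lambda>y. - mat 1 :: real^'m^'m) q x = 0"
      by (rule dir_deriv_eq) (rule has_derivative_const)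
    ultimately show ?thesis by (simp add: anticommutant_def eq_neg_iff_add_eq_0)
  qed
  \<comment> \<open>The product rule gives one cubic term, from differentiating the base point, and
    two terms with second derivatives.\<close>
  have pull: "dir_deriv (\<lambda>x. pullback2 \<psi> ?w x b c) q a =
      (F' q a ** F' q b) \<bullet> F' q c + (F q ** F2 b q a) \<bullet> F' q c + (F q ** F' q b) \<bullet> F2 c q a"
    if "a \<in> L" "b \<in> L" "c \<in> L" for a b c
  proof -
    have "dir_deriv (\<lambda>x. pullback2 \<psi> ?w x b c) q a = dir_deriv (\<lambda>x. (F x ** F' x b) \<bullet> F' x c) q a"
    proof (rule dir_deriv_cong[OF L W that(1)])
      fix x assume x: "x \<in> L \<inter> W"
      show "pullback2 \<psi> ?w x b c = (F x ** F' x b) \<bullet> F' x c"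
        unfolding pullback2_def d\<psi>[OF x that(2)] d\<psi>[OF x that(3)] F(1)[OF x, symmetric]
        by (rule fundamental_form_orthogonal[OF F(2)[OF x]])
    qed
    also have "\<dots> = (F q ** F' q b) \<bullet> F2 c q a + (F q ** F2 b q a + F' q a ** F' q b) \<bullet> F' q c"
      by (rule dir_deriv_eq)
        (intro bounded_bilinear.FDERIV[OF bounded_bilinear_inner] mmult.FDERIV F' F2 U(2))
    finally show ?thesis by (simp add: inner_add_left)
  qed
  have sym: "F2 a q b = F2 b q a" for a b
    by (rule symmetric_second_derivative[OF U(1,2) F'(1) F2])
  have skew: "(F q ** X) \<bullet> Y = - ((F q ** Y) \<bullet> X)" for X Y :: "real^'m^'m"
  proof -
    have "(F q ** X) \<bullet> Y = X \<bullet> (transpose (F q) ** Y)" by (rule inner_matrix_left)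
    also have "transpose (F q) = - F q" using F(2)[OF W(2)] by (simp add: orthogonal_twistor_space_def)
    finally show ?thesis by (simp add: mmult.minus_left inner_commute)
  qed
  note cubic = cubic_form_anticommutant[OF F(2)[OF W(2)] anti anti anti]
  show "dir_deriv (\<lambda>x. pullback2 \<psi> ?w x v w) q u + dir_deriv (\<lambda>x. pullback2 \<psi> ?w x w u) q v +
      dir_deriv (\<lambda>x. pullback2 \<psi> ?w x u v) q w = 0"
    \<comment> \<open>The cubic terms vanish separately. The six second-derivative terms of the
      cyclic sum cancel in pairs: \<open>sym\<close> matches the second derivatives and
      \<open>skew\<close> gives opposite signs.\<close>
    using uvw by (simp add: pull cubic)
      (simp add: sym[of v u] sym[of w u] sym[of w v] skew[of "F2 u q v"] skew[of "F2 u q w"] skew[of "F2 v q w"])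
qed

theorem theorem2p5:
  fixes n :: nat
  assumes "n \<ge> 1" and "CARD('m::finite) = 2 * n"
  shows "kaehler_submanifold (orthogonal_twistor_space :: (real^'m^'m) set) twistor_space
           twistor_metric twistor_J
       \<and> deformation_retract_of (orthogonal_twistor_space :: (real^'m^'m) set) twistor_space"
proof
  note sub = submanifold_twistor_space submanifold_orthogonal_twistor_space
  have "\<forall>A\<in>orthogonal_twistor_space. \<forall>X\<in>tangent_space orthogonal_twistor_space A.
      twistor_J A X \<in> tangent_space orthogonal_twistor_space (A :: real^'m^'m)"
    by (simp add: orthogonal_twistor.tangent_space_eq twistor_J_def mult_skew_anticommutant)
  then show "kaehler_submanifold (orthogonal_twistor_space :: (real^'m^'m) set) twistor_space
           twistor_metric twistor_J"
    unfolding kaehler_submanifold_def complex_submanifold_def kaehler_manifold_def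
    using twistor.hermitian[OF sub(1)] twistor.complex[OF sub(1)] sub(2)
      orthogonal_twistor.hermitian[OF sub(2)] closed_fundamental_form
      orthogonal_twistor.twistor
    by blast
qed (rule twistor_deformation_retract)

end
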